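(* Let $p,q\in\mathbb{R}\setminus\{0\}$ and fix $n\ge 2$. Consider the map $(A,B)\mapsto A^{q/2}B^pA^{q/2}$ from $\mathcal{P}_n\times\mathcal{P}_n$ to $\mathcal{P}_n$. (1) This map is jointly operator convex if and only if $q=2$ and $-1\le p<0$. (2) This map is not jointly operator concave (for any such $p,q$).
   Context: $\mathcal{P}_n$ denotes the set of $n\times n$ positive definite complex matrices. A map $F:\mathcal{P}_n\times\mathcal{P}_n\to M_n(\mathbb{C})_{\mathrm{sa}}$ is jointly operator convex if $F(\lambda A_1+(1-\lambda)A_2,\lambda B_1+(1-\lambda)B_2)\le \lambda F(A_1,B_1)+(1-\lambda)F(A_2,B_2)$ in the Loewner order for all $A_i,B_i\in\mathcal{P}_n$, $\lambda\in[0,1]$; jointly operator concave is defined with the reversed inequality. *)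

theory Defs
  imports "Jordan_Normal_Form.Matrix"
begin

definition ctrans :: "complex mat \<Rightarrow> complex mat" where
  "ctrans A = mat (dim_col A) (dim_row A) (\<lambda>(i,j). cnj (A $$ (j,i)))"

definition hermitian_mat :: "nat \<Rightarrow> complex mat \<Rightarrow> bool" where
  "hermitian_mat n A \<longleftrightarrow> A \<in> carrier_mat n n \<and> ctrans A = A"

definition qform :: "nat \<Rightarrow> complex mat \<Rightarrow> complex vec \<Rightarrow> complex" where
  "qform n A v = (\<Sum>i<n. \<Sum>j<n. cnj (v $ i) * A $$ (i,j) * v $ j)"

definition pos_semidef :: "nat \<Rightarrow> complex mat \<Rightarrow> bool" where
  "pos_semidef n A \<longleftrightarrow> hermitian_mat n A \<and>
     (\<forall>v \<in> carrier_vec n. Re (qform n A v) \<ge> 0)"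

definition pos_def :: "nat \<Rightarrow> complex mat \<Rightarrow> bool" where
  "pos_def n A \<longleftrightarrow> hermitian_mat n A \<and>
     (\<forall>v \<in> carrier_vec n. v \<noteq> 0\<^sub>v n \<longrightarrow> Re (qform n A v) > 0)"

definition loewner_le :: "nat \<Rightarrow> complex mat \<Rightarrow> complex mat \<Rightarrow> bool" where
  "loewner_le n A B \<longleftrightarrow> hermitian_mat n A \<and> hermitian_mat n B \<and> pos_semidef n (B - A)"

definition unitary_mat :: "nat \<Rightarrow> complex mat \<Rightarrow> bool" where
  "unitary_mat n U \<longleftrightarrow> U \<in> carrier_mat n n \<and> ctrans U * U = 1\<^sub>m n"

text \<open>Real power of a positive definite matrix via the spectral decomposition
  A = U diag(lambda) U^*, A^r = U diag(lambda^r) U^* (independent of the chosen decomposition).\<close>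
definition mat_powr :: "nat \<Rightarrow> complex mat \<Rightarrow> real \<Rightarrow> complex mat" where
  "mat_powr n A r = (SOME X. \<exists>U lam. unitary_mat n U \<and> (\<forall>i<n. lam i > 0) \<and>
      A = U * mat_diag n (\<lambda>i. complex_of_real (lam i)) * ctrans U \<and>
      X = U * mat_diag n (\<lambda>i. complex_of_real (lam i powr r)) * ctrans U)"

definition sandwich_map :: "nat \<Rightarrow> real \<Rightarrow> real \<Rightarrow> complex mat \<Rightarrow> complex mat \<Rightarrow> complex mat" where
  "sandwich_map n p q A B = mat_powr n A (q/2) * mat_powr n B p * mat_powr n A (q/2)"

definition jointly_operator_convex ::
  "nat \<Rightarrow> (complex mat \<Rightarrow> complex mat \<Rightarrow> complex mat) \<Rightarrow> bool" where
  "jointly_operator_convex n F \<longleftrightarrow>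
    (\<forall>A1 A2 B1 B2 t. pos_def n A1 \<longrightarrow> pos_def n A2 \<longrightarrow> pos_def n B1 \<longrightarrow> pos_def n B2 \<longrightarrow>
       0 \<le> t \<longrightarrow> t \<le> 1 \<longrightarrow>
       loewner_le n
         (F (complex_of_real t \<cdot>\<^sub>m A1 + complex_of_real (1 - t) \<cdot>\<^sub>m A2)
            (complex_of_real t \<cdot>\<^sub>m B1 + complex_of_real (1 - t) \<cdot>\<^sub>m B2))
         (complex_of_real t \<cdot>\<^sub>m F A1 B1 + complex_of_real (1 - t) \<cdot>\<^sub>m F A2 B2))"

definition jointly_operator_concave ::
  "nat \<Rightarrow> (complex mat \<Rightarrow> complex mat \<Rightarrow> complex mat) \<Rightarrow> bool" where
  "jointly_operator_concave n F \<longleftrightarrow>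
    (\<forall>A1 A2 B1 B2 t. pos_def n A1 \<longrightarrow> pos_def n A2 \<longrightarrow> pos_def n B1 \<longrightarrow> pos_def n B2 \<longrightarrow>
       0 \<le> t \<longrightarrow> t \<le> 1 \<longrightarrow>
       loewner_le n
         (complex_of_real t \<cdot>\<^sub>m F A1 B1 + complex_of_real (1 - t) \<cdot>\<^sub>m F A2 B2)
         (F (complex_of_real t \<cdot>\<^sub>m A1 + complex_of_real (1 - t) \<cdot>\<^sub>m A2)
            (complex_of_real t \<cdot>\<^sub>m B1 + complex_of_real (1 - t) \<cdot>\<^sub>m B2)))"

end

theory Submission
  imports "HOL-Analysis.Equivalence_Lebesgue_Henstock_Integration" "Jordan_Normal_Form.Spectral_Radius" Defs
begin

text \<open>Sufficiency. For $-1 < p < 0$, $B^p$ is a positive mixture of the resolvents $(B+s)^{-1}$,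
  $s > 0$, with weights $s^p$; the case $p = -1$ is the resolvent at $s = 0$. The form
  $(w, B) \mapsto w^* (B+s)^{-1} w$ is jointly convex as a supremum of affine functions.
  Put $w = A v$.

  Necessity. Fix $B$ and let $A$ be diagonal. Since $B^p$ ranges over all positive definite matrices,
  its rank-one limits give, for every real $y$, the midpoint convexity (concavity) of
  $b \mapsto (1 + y b^{q/2})^2$. The linear term in $y$ dominates for small $y$ of either sign, so
  $b^{q/2}$ is midpoint affine and $q = 2$; for $q = 2$ the square is not concave.
  Finally $a^2 b^p$ is jointly convex in $(a, b)$ only if $b^{-p}$ is concave.\<close>

text \<open>Scalars alone cannot determine \<open>q\<close>: a^q b^p is jointly convex for all p, q
  < 0, and jointly concave for p, q > 0 with p + q <= 1. Necessity therefore needs a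
  \<open>B\<close> that does not commute with the diagonal \<open>A\<close>, which is where n >= 2
  enters: the eigenvector (e_0 + e_1)/sqrt 2 of \<open>B\<close> makes two diagonal entries of
  A^(q/2) interfere, and this produces the cross term in y. Once q = 2 is known, scalar matrices
  suffice for the range of \<open>p\<close>. The powers are defined by a choice among spectral
  decompositions, so everything rests on the spectral theorem and on the independence of the chosen
  decomposition. Operator inequalities are always tested as scalar ones on a vector, in the
  eigenbasis of \<open>B\<close>.\<close>

no_notation vec_nth (infixl "$" 90)
no_notation inner (infix "\<bullet>" 70)

subsection \<open>Quadratic forms and the Loewner order\<close>

lemma ctrans_carrier [simp]: "A \<in> carrier_mat m n \<Longrightarrow> ctrans A \<in> carrier_mat n m"
  by (auto simp: ctrans_def)

lemma ctrans_dim [simp]: "dim_row (ctrans A) = dim_col A" "dim_col (ctrans A) = dim_row A"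
  by (auto simp: ctrans_def)

lemma ctrans_index [simp]: "i < dim_col A \<Longrightarrow> j < dim_row A \<Longrightarrow> ctrans A $$ (i,j) = cnj (A $$ (j,i))"
  by (auto simp: ctrans_def)

lemma ctrans_ctrans [simp]: "ctrans (ctrans A) = A"
  by (rule eq_matI) auto

lemma ctrans_mult:
  assumes "A \<in> carrier_mat m k" "B \<in> carrier_mat k n"
  shows "ctrans (A * B) = ctrans B * ctrans A"
  by (rule eq_matI) (use assms in \<open>auto simp: scalar_prod_def mult.commute intro!: sum.cong\<close>)

lemma ctrans_add:
  assumes "A \<in> carrier_mat m n" "B \<in> carrier_mat m n"
  shows "ctrans (A + B) = ctrans A + ctrans B"
  by (rule eq_matI) (use assms in auto)

lemma ctrans_smult_real: "ctrans (complex_of_real t \<cdot>\<^sub>m A) = complex_of_real t \<cdot>\<^sub>m ctrans A"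
  by (rule eq_matI) auto

lemma ctrans_one [simp]: "ctrans (1\<^sub>m n) = 1\<^sub>m n"
  by (rule eq_matI) auto

lemma ctrans_mat_diag_real: "ctrans (mat_diag n (\<lambda>i. complex_of_real (f i))) = mat_diag n (\<lambda>i. complex_of_real (f i))"
  by (rule eq_matI) (auto simp: mat_diag_def)

lemma qform_eq: "M \<in> carrier_mat n n \<Longrightarrow> v \<in> carrier_vec n \<Longrightarrow> qform n M v = (M *\<^sub>v v) \<bullet>c v"
  unfolding qform_def
  by (auto simp: scalar_prod_def atLeast0LessThan sum_distrib_left sum_distrib_right ac_simps
      intro!: sum.cong)

lemma cscalar_ctrans:
  assumes X: "X \<in> carrier_mat m n" and v: "v \<in> carrier_vec n" and w: "w \<in> carrier_vec m"
  shows "(ctrans X *\<^sub>v w) \<bullet>c v = w \<bullet>c (X *\<^sub>v v)"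
proof -
  have "(ctrans X *\<^sub>v w) \<bullet>c v = (\<Sum>i<n. \<Sum>j<m. cnj (X $$ (j,i)) * w $ j * cnj (v $ i))"
    using assms by (auto simp: scalar_prod_def atLeast0LessThan sum_distrib_right intro!: sum.cong)
  also have "\<dots> = (\<Sum>j<m. \<Sum>i<n. cnj (X $$ (j,i)) * w $ j * cnj (v $ i))"
    by (rule sum.swap)
  also have "\<dots> = w \<bullet>c (X *\<^sub>v v)"
    using assms by (auto simp: scalar_prod_def atLeast0LessThan sum_distrib_left ac_simps intro!: sum.cong)
  finally show ?thesis .
qed

text \<open>Moves the outer factors of a product onto the vector. The eigenbasis formula for
  spectral matrices and the evaluation of the sandwich map both rest on it.\<close>

lemma qform_congruence:
  assumes X: "X \<in> carrier_mat m n" and M: "M \<in> carrier_mat m m" and v: "v \<in> carrier_vec n"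
  shows "qform n (ctrans X * M * X) v = qform m M (X *\<^sub>v v)"
proof -
  have "(ctrans X * M * X) *\<^sub>v v = ctrans X *\<^sub>v (M *\<^sub>v (X *\<^sub>v v))"
    using assms mult_carrier_mat[OF ctrans_carrier[OF X] M]
    by (simp add: assoc_mult_mat_vec[of _ n m _ n] assoc_mult_mat_vec[of _ n m _ m] mult_mat_vec_carrier[of _ m n])
  moreover have "ctrans X * M * X \<in> carrier_mat n n" "X *\<^sub>v v \<in> carrier_vec m" "M *\<^sub>v (X *\<^sub>v v) \<in> carrier_vec m"
    using assms by (auto intro!: mult_carrier_mat[of _ n m] mult_mat_vec_carrier[of _ m n] mult_mat_vec_carrier[of _ m m])
  ultimately show ?thesis
    using assms by (simp add: qform_eq cscalar_ctrans[OF X v] del: index_mult_mat_vec)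
qed

lemma qform_diag:
  "v \<in> carrier_vec n \<Longrightarrow>
    qform n (mat_diag n (\<lambda>i. complex_of_real (f i))) v = complex_of_real (\<Sum>i<n. f i * (cmod (v $ i))\<^sup>2)"
proof -
  assume v: "v \<in> carrier_vec n"
  have "(\<Sum>j<n. cnj (v $ i) * mat_diag n (\<lambda>i. complex_of_real (f i)) $$ (i,j) * v $ j)
        = complex_of_real (f i * (cmod (v $ i))\<^sup>2)" if "i < n" for i
  proof -
    have "(\<Sum>j<n. cnj (v $ i) * mat_diag n (\<lambda>i. complex_of_real (f i)) $$ (i,j) * v $ j)
       = (\<Sum>j<n. if j = i then cnj (v $ i) * complex_of_real (f i) * v $ i else 0)"
      using that by (intro sum.cong) (auto simp: mat_diag_def)
    also have "\<dots> = complex_of_real (f i * (cmod (v $ i))\<^sup>2)"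
      using that by (simp add: complex_norm_square ac_simps del: of_real_power)
    finally show ?thesis .
  qed
  then show ?thesis by (simp add: qform_def)
qed

lemma qform_add:
  assumes "A \<in> carrier_mat n n" "B \<in> carrier_mat n n"
  shows "qform n (A + B) v = qform n A v + qform n B v"
  using assms by (simp add: qform_def algebra_simps sum.distrib)

lemma qform_smult:
  assumes "A \<in> carrier_mat n n"
  shows "qform n (c \<cdot>\<^sub>m A) v = c * qform n A v"
  using assms by (simp add: qform_def algebra_simps sum_distrib_left)

lemma qform_diff:
  assumes "A \<in> carrier_mat n n" "B \<in> carrier_mat n n"
  shows "qform n (A - B) v = qform n A v - qform n B v"
  using assms by (simp add: qform_def algebra_simps sum_subtractf)

lemma hermitian_mat_combination:
  assumes "hermitian_mat n A" "hermitian_mat n B"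
  shows "hermitian_mat n (complex_of_real s \<cdot>\<^sub>m A + complex_of_real t \<cdot>\<^sub>m B)"
  using assms by (auto simp: hermitian_mat_def ctrans_add[of _ n n] ctrans_smult_real)

lemma hermitian_mat_diff:
  assumes "hermitian_mat n A" "hermitian_mat n B"
  shows "hermitian_mat n (A - B)"
proof -
  have "A - B = complex_of_real 1 \<cdot>\<^sub>m A + complex_of_real (-1) \<cdot>\<^sub>m B"
    using assms by (intro eq_matI) (auto simp: hermitian_mat_def)
  then show ?thesis using hermitian_mat_combination[OF assms] by metis
qed

text \<open>Reduces an operator inequality to one real inequality per vector; the difference of the
  two sides is Hermitian automatically.\<close>

lemma loewner_le_iff:
  assumes "hermitian_mat n A" "hermitian_mat n B"
  shows "loewner_le n A B \<longleftrightarrow> (\<forall>v\<in>carrier_vec n. Re (qform n A v) \<le> Re (qform n B v))"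
  using assms hermitian_mat_diff[OF assms(2,1)]
  by (auto simp: loewner_le_def pos_semidef_def hermitian_mat_def qform_diff)

lemma pos_def_convex_combination:
  assumes "pos_def n A" "pos_def n B" "0 \<le> t" "t \<le> 1"
  shows "pos_def n (complex_of_real t \<cdot>\<^sub>m A + complex_of_real (1 - t) \<cdot>\<^sub>m B)"
proof -
  have car: "A \<in> carrier_mat n n" "B \<in> carrier_mat n n"
    using assms by (auto simp: pos_def_def hermitian_mat_def)
  have "Re (qform n (complex_of_real t \<cdot>\<^sub>m A + complex_of_real (1 - t) \<cdot>\<^sub>m B) v) > 0"
    if "v \<in> carrier_vec n" "v \<noteq> 0\<^sub>v n" for v
  proof -
    have pos: "Re (qform n A v) > 0" "Re (qform n B v) > 0"
      using assms that by (auto simp: pos_def_def)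
    have "t * Re (qform n A v) + (1 - t) * Re (qform n B v) > 0"
    proof (cases "t = 0")
      case False
      with pos assms show ?thesis by (intro add_pos_nonneg) auto
    qed (use pos in auto)
    then show ?thesis
      using car by (simp add: qform_add[of _ n] qform_smult[of _ n] del: of_real_diff)
  qed
  then show ?thesis
    using assms hermitian_mat_combination unfolding pos_def_def by blast
qed

subsection \<open>Spectral decomposition and real powers\<close>

text \<open>Names the expression that occurs twice in \<open>mat_powr_def\<close>, so that a matrix
  power becomes a change of \<open>lam\<close> with \<open>U\<close> kept.\<close>

definition spectral_mat :: "nat \<Rightarrow> complex mat \<Rightarrow> (nat \<Rightarrow> real) \<Rightarrow> complex mat" where
  "spectral_mat n U lam = U * mat_diag n (\<lambda>i. complex_of_real (lam i)) * ctrans U"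

lemma unitary_matD:
  assumes "unitary_mat n U"
  shows "U \<in> carrier_mat n n" "ctrans U * U = 1\<^sub>m n" "U * ctrans U = 1\<^sub>m n"
  using assms mat_mult_left_right_inverse[of "ctrans U" n U] by (auto simp: unitary_mat_def)

lemma unitary_mat_ctrans:
  assumes "unitary_mat n U"
  shows "unitary_mat n (ctrans U)"
  using unitary_matD[OF assms] by (simp add: unitary_mat_def)

lemma unitary_mat_one: "unitary_mat n (1\<^sub>m n)"
  by (simp add: unitary_mat_def)

lemma unitary_mat_mult:
  assumes "unitary_mat n U" "unitary_mat n V"
  shows "unitary_mat n (U * V)"
proof -
  note U = unitary_matD[OF assms(1)] and V = unitary_matD[OF assms(2)]
  have "ctrans (U * V) * (U * V) = ctrans V * ((ctrans U * U) * V)"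
    using U(1) V(1) by (simp add: ctrans_mult[OF U(1) V(1)] assoc_mult_mat[of _ n n _ n _ n])
  then show ?thesis
    using U V by (simp add: unitary_mat_def)
qed

lemma unitary_cscalar:
  assumes "unitary_mat n U" "x \<in> carrier_vec n" "y \<in> carrier_vec n"
  shows "(U *\<^sub>v x) \<bullet>c (U *\<^sub>v y) = x \<bullet>c y"
proof -
  note U = unitary_matD[OF assms(1)]
  have "(U *\<^sub>v x) \<bullet>c (U *\<^sub>v y) = (ctrans U *\<^sub>v (U *\<^sub>v x)) \<bullet>c y"
    using U assms by (subst cscalar_ctrans) auto
  also have "ctrans U *\<^sub>v (U *\<^sub>v x) = (ctrans U * U) *\<^sub>v x"
    using U assms by (intro assoc_mult_mat_vec[symmetric]) auto
  finally show ?thesis using U assms by simp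
qed

lemma spectral_mat_carrier [simp]: "U \<in> carrier_mat n n \<Longrightarrow> spectral_mat n U lam \<in> carrier_mat n n"
  unfolding spectral_mat_def by (intro mult_carrier_mat[of _ n n]) auto

lemma spectral_mat_one: "spectral_mat n (1\<^sub>m n) lam = mat_diag n (\<lambda>i. complex_of_real (lam i))"
  by (simp add: spectral_mat_def right_mult_one_mat[of _ n n] left_mult_one_mat[of _ n n])

lemma hermitian_congruence:
  assumes "hermitian_mat m M" "X \<in> carrier_mat n m"
  shows "hermitian_mat n (X * M * ctrans X)"
proof -
  have M: "M \<in> carrier_mat m m" "ctrans M = M" using assms by (auto simp: hermitian_mat_def)
  have "ctrans (X * M * ctrans X) = X * M * ctrans X"
    using assms(2) M
    by (subst ctrans_mult[of _ n m _ n], simp, simp, subst ctrans_mult[of _ n m _ m], simp, simp)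
      (simp add: assoc_mult_mat[of _ n m _ m _ n])
  moreover have "X * M * ctrans X \<in> carrier_mat n n"
    using assms(2) M by (intro mult_carrier_mat[of _ n m]) auto
  ultimately show ?thesis by (simp add: hermitian_mat_def)
qed

lemma hermitian_spectral_mat: "U \<in> carrier_mat n n \<Longrightarrow> hermitian_mat n (spectral_mat n U lam)"
  unfolding spectral_mat_def
  by (rule hermitian_congruence) (auto simp: hermitian_mat_def ctrans_mat_diag_real)

lemma qform_spectral_mat:
  assumes "U \<in> carrier_mat n n" "v \<in> carrier_vec n"
  shows "qform n (spectral_mat n U lam) v
    = complex_of_real (\<Sum>i<n. lam i * (cmod ((ctrans U *\<^sub>v v) $ i))\<^sup>2)"
  using qform_congruence[of "ctrans U" n n "mat_diag n (\<lambda>i. complex_of_real (lam i))" v] assms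
    qform_diag[of "ctrans U *\<^sub>v v" n lam]
  by (simp add: spectral_mat_def mult_mat_vec_carrier[of _ n n] del: of_real_sum index_mult_mat_vec)

lemma pos_def_spectral_mat:
  assumes U: "unitary_mat n U" and lam: "\<And>i. i < n \<Longrightarrow> lam i > 0"
  shows "pos_def n (spectral_mat n U lam)"
  unfolding pos_def_def
proof (intro conjI ballI impI)
  note UD = unitary_matD[OF U]
  show "hermitian_mat n (spectral_mat n U lam)"
    using UD by (intro hermitian_spectral_mat)
  fix v :: "complex Matrix.vec" assume v: "v \<in> carrier_vec n" "v \<noteq> 0\<^sub>v n"
  define w where "w = ctrans U *\<^sub>v v"
  have w: "w \<in> carrier_vec n" using UD v unfolding w_def by (intro mult_mat_vec_carrier[of _ n n]) auto
  have "U *\<^sub>v w = (U * ctrans U) *\<^sub>v v"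
    unfolding w_def using UD v by (intro assoc_mult_mat_vec[symmetric]) auto
  then have "U *\<^sub>v w = v" using UD v by simp
  moreover have "U *\<^sub>v 0\<^sub>v n = 0\<^sub>v n"
    using UD by (intro eq_vecI) (auto simp: scalar_prod_def)
  ultimately have "w \<noteq> 0\<^sub>v n" using v by auto
  then obtain i where i: "i < n" "w $ i \<noteq> 0" using w by (metis carrier_vecD eq_vecI index_zero_vec)
  have "(\<Sum>i<n. lam i * (cmod (w $ i))\<^sup>2) > 0"
    using i lam by (intro sum_pos2[of _ i]) (auto simp: less_imp_le)
  then show "Re (qform n (spectral_mat n U lam) v) > 0"
    using UD v by (simp add: qform_spectral_mat w_def)
qed

text \<open>Two diagonalisations $U D U^* = V E V^*$ are intertwined by $W = V^* U$, whose nonzero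
  entries only link equal eigenvalues; hence $W$ also intertwines $f(D)$ and $f(E)$.\<close>

lemma spectral_mat_fun_eq:
  assumes U: "unitary_mat n U" and V: "unitary_mat n V"
    and eq: "spectral_mat n U lam = spectral_mat n V mu"
  shows "spectral_mat n U (\<lambda>i. f (lam i)) = spectral_mat n V (\<lambda>i. f (mu i))"
proof -
  let ?D = "\<lambda>l. mat_diag n (\<lambda>i. complex_of_real (l i))"
  note UD = unitary_matD[OF U] and VD = unitary_matD[OF V]
  have a: "A * B * C = A * (B * C)" if "A \<in> carrier_mat n n" "B \<in> carrier_mat n n" "C \<in> carrier_mat n n"
    for A B C :: "complex mat" using that by (rule assoc_mult_mat)
  have m: "A * B \<in> carrier_mat n n" if "A \<in> carrier_mat n n" "B \<in> carrier_mat n n"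
    for A B :: "complex mat" using that by (rule mult_carrier_mat)
  define W where "W = ctrans V * U"
  have W: "W \<in> carrier_mat n n" using UD VD unfolding W_def by (intro mult_carrier_mat[of _ n n]) auto
  \<comment> \<open>Stated for arbitrary diagonals, as it serves twice: for the eigenvalues
    themselves and for their images under \<open>f\<close>.\<close>
  have intertwine: "W * ?D l = ?D m * W \<longleftrightarrow> spectral_mat n U l = spectral_mat n V m" for l m
  proof
    assume *: "W * ?D l = ?D m * W"
    have "spectral_mat n U l = (V * ctrans V) * (U * ?D l * ctrans U)"
      using UD VD by (simp add: spectral_mat_def)
    also have "\<dots> = V * (W * ?D l) * ctrans U"
      using UD(1) VD(1) by (simp add: W_def a m)
    also have "\<dots> = V * ?D m * ctrans V * (U * ctrans U)"
      unfolding * using UD(1) VD(1) by (simp add: W_def a m)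
    finally show "spectral_mat n U l = spectral_mat n V m"
      using UD VD by (simp add: spectral_mat_def)
  next
    assume *: "spectral_mat n U l = spectral_mat n V m"
    have "W * ?D l = ctrans V * (U * ?D l) * (ctrans U * U)"
      using UD VD by (simp add: W_def a m right_mult_one_mat[of _ n n])
    also have "\<dots> = ctrans V * (spectral_mat n U l) * U"
      using UD(1) VD(1) by (simp add: a m spectral_mat_def)
    also have "\<dots> = (ctrans V * V) * (?D m * (ctrans V * U))"
      unfolding * using UD(1) VD(1) by (simp add: a m spectral_mat_def)
    also have "\<dots> = ?D m * W"
      using UD VD by (simp add: W_def m left_mult_one_mat[of _ n n])
    finally show "W * ?D l = ?D m * W" .
  qed
  have entry: "W * ?D l = ?D m * W \<longleftrightarrow> (\<forall>i<n. \<forall>j<n. W $$ (i,j) = 0 \<or> l j = m i)" for l m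
    using W unfolding mat_diag_mult_left[OF W] mat_diag_mult_right[OF W]
    by (auto simp: mat_eq_iff mult.commute)
  from eq show ?thesis
    unfolding intertwine[symmetric] entry by metis
qed

text \<open>\<open>spectral_mat_fun_eq\<close> for the power function shows that all admissible
  decompositions yield the same matrix, so the choice in \<open>mat_powr_def\<close> has a single
  candidate.\<close>

lemma mat_powr_spectral_mat:
  assumes U: "unitary_mat n U" and lam: "\<And>i. i < n \<Longrightarrow> lam i > 0"
  shows "mat_powr n (spectral_mat n U lam) r = spectral_mat n U (\<lambda>i. lam i powr r)"
  unfolding mat_powr_def spectral_mat_def[symmetric]
proof (rule some_equality)
  show "\<exists>V mu. unitary_mat n V \<and> (\<forall>i<n. 0 < mu i) \<and> spectral_mat n U lam = spectral_mat n V mu \<and>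
      spectral_mat n U (\<lambda>i. lam i powr r) = spectral_mat n V (\<lambda>i. mu i powr r)"
    using assms by blast
  fix X
  assume "\<exists>V mu. unitary_mat n V \<and> (\<forall>i<n. 0 < mu i) \<and> spectral_mat n U lam = spectral_mat n V mu \<and>
      X = spectral_mat n V (\<lambda>i. mu i powr r)"
  then show "X = spectral_mat n U (\<lambda>i. lam i powr r)"
    using spectral_mat_fun_eq[OF U, where f = "\<lambda>x. x powr r"] by metis
qed

section \<open>Spectral theorem for Hermitian matrices\<close>

lemma spectral_mat_index:
  assumes "U \<in> carrier_mat n n" "i < n" "j < n"
  shows "spectral_mat n U lam $$ (i,j) = (\<Sum>k<n. U $$ (i,k) * complex_of_real (lam k) * cnj (U $$ (j,k)))"
  using assms unfolding spectral_mat_def mat_diag_mult_right[OF assms(1)]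
  by (simp add: scalar_prod_def atLeast0LessThan)

lemma unitary_mat_iff:
  "unitary_mat n U \<longleftrightarrow> U \<in> carrier_mat n n \<and>
    (\<forall>i<n. \<forall>j<n. (\<Sum>k<n. cnj (U $$ (k,i)) * U $$ (k,j)) = (if i = j then 1 else 0))"
proof -
  have "ctrans U * U = 1\<^sub>m n \<longleftrightarrow> (\<forall>i<n. \<forall>j<n. (\<Sum>k<n. cnj (U $$ (k,i)) * U $$ (k,j)) = (if i = j then 1 else 0))"
    if U: "U \<in> carrier_mat n n"
  proof -
    have "(ctrans U * U) $$ (i,j) = (\<Sum>k<n. cnj (U $$ (k,i)) * U $$ (k,j))" if "i < n" "j < n" for i j
      using U that by (simp add: scalar_prod_def atLeast0LessThan)
    then show ?thesis
      using U by (simp add: mat_eq_iff)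
  qed
  then show ?thesis unfolding unitary_mat_def by blast
qed

lemma spectral_mat_congruence:
  assumes "W \<in> carrier_mat n n" "U \<in> carrier_mat n n"
  shows "W * spectral_mat n U lam * ctrans W = spectral_mat n (W * U) lam"
proof -
  have a: "A * B * C = A * (B * C)" if "A \<in> carrier_mat n n" "B \<in> carrier_mat n n" "C \<in> carrier_mat n n"
    for A B C :: "complex mat" using that by (rule assoc_mult_mat)
  have m: "A * B \<in> carrier_mat n n" if "A \<in> carrier_mat n n" "B \<in> carrier_mat n n"
    for A B :: "complex mat" using that by (rule mult_carrier_mat)
  show ?thesis
    using assms by (simp add: spectral_mat_def ctrans_mult[OF assms] a m)
qed

text \<open>Completing \<open>v\<close> to a basis and orthogonalising keeps \<open>v\<close> as the
  first vector. The result is orthogonal but not normalised, hence the division by norms and the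
  scalar \<open>c\<close>.\<close>

lemma unitary_mat_with_first_col:
  assumes v: "v \<in> carrier_vec n" "v \<noteq> 0\<^sub>v n"
  obtains W c where "unitary_mat n W" "col W 0 = c \<cdot>\<^sub>v v"
proof -
  interpret cof_vec_space n "TYPE(complex)" .
  define b where "b = basis_completion v"
  define ws where "ws = gram_schmidt n b"
  have b: "set b \<subseteq> carrier_vec n" "distinct b" "\<not> lin_dep (set b)" "hd b = v" "length b = n"
    using basis_completion[OF v, folded b_def] by auto
  have n: "n \<noteq> 0" using v by (metis eq_vecI carrier_vecD index_zero_vec(2) not_less0)
  from b(4) b(5) n obtain vs where bv: "b = v # vs" by (cases b) auto
  note gs = gram_schmidt_result[OF b(1) b(2) b(3) ws_def]
  have len: "length ws = n" using gs(4) b(5) by simp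
  have hd: "ws ! 0 = v" using gram_schmidt_hd[OF v(1), of vs, folded bv] n len
    by (metis hd_conv_nth length_0_conv ws_def)
  have ws: "ws ! i \<in> carrier_vec n" if "i < n" for i using gs(3) that len by auto
  define nrm where "nrm w = (\<Sum>k<n. (cmod (w $ k))\<^sup>2)" for w :: "complex Matrix.vec"
  define W where "W = Matrix.mat n n (\<lambda>(k,i). complex_of_real (1 / sqrt (nrm (ws ! i))) * (ws ! i) $ k)"
  have ip: "(ws ! j) \<bullet>c (ws ! i) = (\<Sum>k<n. cnj (ws ! i $ k) * ws ! j $ k)" if "i < n" "j < n" for i j
    using ws[OF that(1)] ws[OF that(2)] by (simp add: scalar_prod_def atLeast0LessThan mult.commute)
  have nrm: "(\<Sum>k<n. cnj (ws ! i $ k) * ws ! i $ k) = complex_of_real (nrm (ws ! i))" for i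
    by (simp add: nrm_def complex_norm_square mult.commute del: of_real_power)
  \<comment> \<open>\<open>corthogonalD\<close> says that the product of two members vanishes
    exactly when their indices differ, so equal indices give a nonzero norm.\<close>
  have nrm_pos: "nrm (ws ! i) > 0" if "i < n" for i
  proof -
    have "nrm (ws ! i) \<noteq> 0"
      using corthogonalD[OF gs(2), of i i] that len ip[OF that that] nrm[of i] by simp
    moreover have "nrm (ws ! i) \<ge> 0" by (simp add: nrm_def sum_nonneg)
    ultimately show ?thesis by simp
  qed
  have "unitary_mat n W"
    unfolding unitary_mat_iff
  proof (intro conjI allI impI)
    show "W \<in> carrier_mat n n" by (simp add: W_def)
    fix i j assume ij: "i < n" "j < n"
    let ?s = "complex_of_real (1 / sqrt (nrm (ws ! i))) * complex_of_real (1 / sqrt (nrm (ws ! j)))"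
    have *: "(\<Sum>k<n. cnj (W $$ (k,i)) * W $$ (k,j)) = ?s * (\<Sum>k<n. cnj (ws ! i $ k) * ws ! j $ k)"
      using ij by (simp add: W_def sum_distrib_left ac_simps)
    show "(\<Sum>k<n. cnj (W $$ (k,i)) * W $$ (k,j)) = (if i = j then 1 else 0)"
    proof (cases "i = j")
      case True
      have "?s * (\<Sum>k<n. cnj (ws ! i $ k) * ws ! j $ k)
          = complex_of_real (1 / sqrt (nrm (ws ! i)) * (1 / sqrt (nrm (ws ! i))) * nrm (ws ! i))"
        using True nrm by (simp only: of_real_mult)
      also have "\<dots> = 1" using nrm_pos[OF ij(1)] by (simp add: divide_simps)
      finally show ?thesis using True * by simp
    next
      case False
      then show ?thesis
        using * ip[OF ij] corthogonalD[OF gs(2), of j i] ij len by simp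
    qed
  qed
  moreover have "col W 0 = complex_of_real (1 / sqrt (nrm v)) \<cdot>\<^sub>v v"
    using v n hd by (intro eq_vecI) (auto simp: W_def)
  ultimately show ?thesis by (rule that)
qed

text \<open>Induction by deflation: with an eigenvector as first column of a unitary
  \<open>W\<close>, the conjugated matrix has first column (e, 0, ..., 0). Hermiticity clears the
  first row and makes e real, and the remaining block is Hermitian of smaller size.\<close>

theorem hermitian_spectral_decomposition:
  assumes "hermitian_mat n A"
  obtains U lam where "unitary_mat n U" "A = spectral_mat n U lam"
proof -
  have "\<exists>U lam. unitary_mat n U \<and> A = spectral_mat n U lam"
    using assms
  proof (induction n arbitrary: A)
    case 0
    have "unitary_mat 0 (1\<^sub>m 0)" by (rule unitary_mat_one)
    moreover have "A = spectral_mat 0 (1\<^sub>m 0) (\<lambda>_. 0)"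
      using 0 by (intro eq_matI) (auto simp: hermitian_mat_def spectral_mat_def)
    ultimately show ?case by blast
  next
    case (Suc n)
    let ?N = "Suc n"
    have A: "A \<in> carrier_mat ?N ?N" using Suc.prems by (simp add: hermitian_mat_def)
    obtain e v where ev: "eigenvector A v e"
      using spectrum_non_empty[OF A] by (auto simp: spectrum_def eigenvalue_def)
    then have v: "v \<in> carrier_vec ?N" "v \<noteq> 0\<^sub>v ?N" "A *\<^sub>v v = e \<cdot>\<^sub>v v"
      using A by (auto simp: eigenvector_def)
    obtain W c where W: "unitary_mat ?N W" and col0: "col W 0 = c \<cdot>\<^sub>v v"
      using unitary_mat_with_first_col[OF v(1,2)] .
    note WD = unitary_matD[OF W]
    define B where "B = ctrans W * A * W"
    have B: "hermitian_mat ?N B"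
      using hermitian_congruence[OF Suc.prems ctrans_carrier[OF WD(1)]] by (simp add: B_def)
    then have Bcar: "B \<in> carrier_mat ?N ?N" by (simp add: hermitian_mat_def)
    have Bh: "B $$ (i,j) = cnj (B $$ (j,i))" if "i < ?N" "j < ?N" for i j
      using B that by (metis hermitian_mat_def carrier_matD ctrans_index)
    have "A *\<^sub>v col W 0 = e \<cdot>\<^sub>v col W 0"
      unfolding col0 using A v by (simp add: mult_mat_vec[OF A] smult_smult_assoc mult.commute)
    then have "col (A * W) 0 = e \<cdot>\<^sub>v col W 0"
      using A WD(1) by (metis col_mult2 zero_less_Suc)
    then have AW: "(A * W) $$ (k,0) = e * W $$ (k,0)" if "k < ?N" for k
      using A WD(1) that by (metis carrier_matD dim_col index_col index_mult_mat(2,3) index_smult_vec(1) zero_less_Suc)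
    \<comment> \<open>The first column of \<open>A * W\<close> is e times that of \<open>W\<close>,
      so the orthonormal columns of \<open>W\<close> leave only the top entry.\<close>
    have B0: "B $$ (i,0) = (if i = 0 then e else 0)" if i: "i < ?N" for i
    proof -
      have "B = ctrans W * (A * W)"
        unfolding B_def using A WD(1) by (intro assoc_mult_mat) auto
      then have "B $$ (i,0) = (\<Sum>k<?N. cnj (W $$ (k,i)) * (A * W) $$ (k,0))"
        using A WD(1) i by (simp add: scalar_prod_def atLeast0LessThan)
      also have "\<dots> = e * (\<Sum>k<?N. cnj (W $$ (k,i)) * W $$ (k,0))"
        unfolding sum_distrib_left by (intro sum.cong) (auto simp: AW)
      also have "\<dots> = (if i = 0 then e else 0)"
        using W i unfolding unitary_mat_iff by auto
      finally show ?thesis .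
    qed
    have e_real: "complex_of_real (Re e) = e"
      using Bh[of 0 0] B0[of 0] by (simp add: complex_eq_iff)
    define C where "C = Matrix.mat n n (\<lambda>(i,j). B $$ (Suc i, Suc j))"
    have "hermitian_mat n C"
      unfolding hermitian_mat_def
    proof
      show "ctrans C = C"
        by (rule eq_matI) (auto simp: C_def intro: Bh[symmetric])
    qed (simp add: C_def)
    from Suc.IH[OF this] obtain V mu where V: "unitary_mat n V" and C: "C = spectral_mat n V mu"
      by blast
    note VD = unitary_matD[OF V]
    \<comment> \<open>Block sum of the 1 x 1 identity and \<open>V\<close>. The new eigenvalue takes
      index 0, so \<open>V\<close> and \<open>mu\<close> are read at shifted indices.\<close>
    define V1 where "V1 = Matrix.mat ?N ?N (\<lambda>(i,j). if i = 0 \<or> j = 0 then (if i = j then 1 else 0)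
      else V $$ (i - 1, j - 1))"
    define lam where "lam i = (if i = 0 then Re e else mu (i - 1))" for i
    have V1: "V1 \<in> carrier_mat ?N ?N" by (simp add: V1_def)
    have uV1: "unitary_mat ?N V1"
      unfolding unitary_mat_iff
    proof (intro conjI allI impI)
      fix i j assume "i < ?N" "j < ?N"
      then show "(\<Sum>k<?N. cnj (V1 $$ (k,i)) * V1 $$ (k,j)) = (if i = j then 1 else 0)"
        using V unfolding unitary_mat_iff
        by (cases i; cases j) (simp_all add: V1_def sum.lessThan_Suc_shift del: sum.lessThan_Suc)
    qed (rule V1)
    have "B = spectral_mat ?N V1 lam"
    proof (rule eq_matI)
      fix i j assume "i < dim_row (spectral_mat ?N V1 lam)" "j < dim_col (spectral_mat ?N V1 lam)"
      then have ij: "i < ?N" "j < ?N" using carrier_matD[OF spectral_mat_carrier[OF V1]] by simp_all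
      have Cij: "B $$ (Suc i, Suc j) = (\<Sum>k<n. V $$ (i,k) * complex_of_real (mu k) * cnj (V $$ (j,k)))"
        if "i < n" "j < n" for i j
      proof -
        have "B $$ (Suc i, Suc j) = C $$ (i,j)" using that by (simp add: C_def)
        then show ?thesis unfolding C spectral_mat_index[OF VD(1) that] .
      qed
      show "B $$ (i,j) = spectral_mat ?N V1 lam $$ (i,j)"
        unfolding spectral_mat_index[OF V1 ij]
        using ij B0 Bh[of 0 j] e_real
        by (cases i; cases j) (simp_all add: V1_def lam_def Cij sum.lessThan_Suc_shift del: sum.lessThan_Suc)
    qed (use carrier_matD[OF spectral_mat_carrier[OF V1]] Bcar in auto)
    then have "W * B * ctrans W = spectral_mat ?N (W * V1) lam"
      using spectral_mat_congruence[OF WD(1) V1] by simp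
    moreover have "W * B * ctrans W = A"
    proof -
      have a: "X * Y * Z = X * (Y * Z)" if "X \<in> carrier_mat ?N ?N" "Y \<in> carrier_mat ?N ?N" "Z \<in> carrier_mat ?N ?N"
        for X Y Z :: "complex mat" using that by (rule assoc_mult_mat)
      have m: "X * Y \<in> carrier_mat ?N ?N" if "X \<in> carrier_mat ?N ?N" "Y \<in> carrier_mat ?N ?N"
        for X Y :: "complex mat" using that by (rule mult_carrier_mat)
      have "W * B * ctrans W = (W * ctrans W) * A * (W * ctrans W)"
        using WD(1) A by (simp add: B_def a m)
      then show ?thesis using WD A by simp
    qed
    ultimately show ?case
      using unitary_mat_mult[OF W uV1] by metis
  qed
  with that show ?thesis by blast
qed

text \<open>The k-th column of \<open>U\<close> is an eigenvector, and the form takes the value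
  \<open>lam k\<close> there.\<close>

lemma pos_def_spectral_decomposition:
  assumes "pos_def n A"
  obtains U lam where "unitary_mat n U" "A = spectral_mat n U lam" "\<And>i. i < n \<Longrightarrow> lam i > 0"
proof -
  obtain U lam where U: "unitary_mat n U" and A: "A = spectral_mat n U lam"
    using hermitian_spectral_decomposition assms unfolding pos_def_def by metis
  note UD = unitary_matD[OF U]
  have "lam k > 0" if k: "k < n" for k
  proof -
    let ?v = "U *\<^sub>v unit_vec n k"
    have v: "?v \<in> carrier_vec n" using UD by (intro mult_mat_vec_carrier[of _ n n]) auto
    have "ctrans U *\<^sub>v ?v = (ctrans U * U) *\<^sub>v unit_vec n k"
      using UD by (intro assoc_mult_mat_vec[symmetric]) auto
    then have Uv: "ctrans U *\<^sub>v ?v = unit_vec n k" using UD by simp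
    have "ctrans U *\<^sub>v 0\<^sub>v n = 0\<^sub>v n"
      using UD by (intro eq_vecI) (auto simp: scalar_prod_def)
    with Uv k have "?v \<noteq> 0\<^sub>v n" by (metis index_unit_vec(1) index_zero_vec(1) zero_neq_one)
    with assms v have "Re (qform n A ?v) > 0" by (simp add: pos_def_def)
    moreover have "(\<Sum>i<n. lam i * (cmod (unit_vec n k $ i))\<^sup>2) = (\<Sum>i<n. if i = k then lam i else 0)"
      using k by (intro sum.cong) auto
    ultimately show ?thesis
      using k qform_spectral_mat[OF UD(1) v, of lam] unfolding A Uv by simp
  qed
  with U A that show ?thesis by blast
qed

subsection \<open>Real powers\<close>

text \<open>The mean value theorem on [1,2] and on [2,3] writes the second difference of x^s as a
  difference of derivatives, so its sign follows from the monotonicity of x^(s-1).\<close>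

lemma powr_midpoint_difference:
  fixes s :: real
  obtains x y where "1 < x" "x < y" "y < 3" "1 + 3 powr s - 2 * 2 powr s = s * (y powr (s - 1) - x powr (s - 1))"
proof -
  have d: "((\<lambda>x. x powr s) has_real_derivative s * x powr (s - 1)) (at x)" if "x > 0" for x :: real
    using that by (auto intro!: derivative_eq_intros simp: powr_diff)
  obtain x where x: "1 < x" "x < 2" "2 powr s - 1 powr s = (2 - 1) * (s * x powr (s - 1))"
    using MVT2[of 1 2 "\<lambda>x. x powr s" "\<lambda>x. s * x powr (s - 1)"] d by force
  obtain y where y: "2 < y" "y < 3" "3 powr s - 2 powr s = (3 - 2) * (s * y powr (s - 1))"
    using MVT2[of 2 3 "\<lambda>x. x powr s" "\<lambda>x. s * x powr (s - 1)"] d by force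
  show ?thesis
    using x y by (intro that[of x y]) (auto simp: algebra_simps)
qed

lemma powr_midpoint_eq_imp:
  fixes s :: real
  assumes "1 + 3 powr s = 2 * 2 powr s" "s \<noteq> 0"
  shows "s = 1"
proof -
  obtain x y where xy: "1 < x" "x < y" "1 + 3 powr s - 2 * 2 powr s = s * (y powr (s - 1) - x powr (s - 1))"
    by (rule powr_midpoint_difference[of s]) blast
  then have "y powr (s - 1) = x powr (s - 1)" using assms by simp
  then show ?thesis
    using xy powr_less_mono2[of "s - 1" x y] powr_less_mono2_neg[of "s - 1" x y]
    by (cases "s - 1" "0::real" rule: linorder_cases) auto
qed

text \<open>The factors s and y^(s-1) - x^(s-1) are both negative for s < 0 and both positive for s
  > 1, so outside [0,1] the second difference is strictly positive.\<close>

lemma powr_midpoint_le_imp: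
  fixes s :: real
  assumes "1 + 3 powr s \<le> 2 * 2 powr s"
  shows "0 \<le> s" "s \<le> 1"
proof -
  obtain x y where xy: "1 < x" "x < y" "1 + 3 powr s - 2 * 2 powr s = s * (y powr (s - 1) - x powr (s - 1))"
    by (rule powr_midpoint_difference[of s]) blast
  then have le: "s * (y powr (s - 1) - x powr (s - 1)) \<le> 0" using assms by simp
  show "0 \<le> s"
  proof (rule ccontr)
    assume "\<not> 0 \<le> s"
    with xy powr_less_mono2_neg[of "s - 1" x y] have "s * (y powr (s - 1) - x powr (s - 1)) > 0"
      by (intro mult_neg_neg) auto
    with le show False by simp
  qed
  show "s \<le> 1"
  proof (rule ccontr)
    assume "\<not> s \<le> 1"
    with xy powr_less_mono2[of "s - 1" x y] have "s * (y powr (s - 1) - x powr (s - 1)) > 0"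
      by (intro mult_pos_pos) auto
    with le show False by simp
  qed
qed

text \<open>Carries improper integrals of powers over from gauge to Lebesgue integration; for a
  nonnegative integrand, a finite value is integrability.\<close>

lemma integrable_lborel_has_integral:
  fixes f :: "real \<Rightarrow> real"
  assumes "f \<in> borel_measurable borel" "\<And>x. x \<in> A \<Longrightarrow> 0 \<le> f x" "A \<in> sets borel" "(f has_integral I) A"
  shows "integrable lborel (\<lambda>x. indicator A x * f x)"
proof -
  have m: "(\<lambda>x. indicator A x * f x) \<in> borel_measurable borel"
    using assms by measurable
  have "((\<lambda>x. indicator A x * f x) has_integral I) UNIV"
  proof -
    have "(\<lambda>x. indicator A x * f x) = (\<lambda>x. if x \<in> A then f x else 0)" by (auto simp: indicator_def)
    then show ?thesis using assms(4) by (simp only: has_integral_restrict_UNIV)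
  qed
  then have "(\<integral>\<^sup>+x. ennreal (indicator A x * f x) \<partial>lborel) = ennreal I"
    using m assms(2) by (intro nn_integral_has_integral_lborel) (auto simp: indicator_def)
  then show ?thesis
    using m assms(2) by (intro integrableI_nonneg) (auto simp: indicator_def)
qed

text \<open>The substitution s = b u factors b^p out of the integral, and \<open>c\<close> is the
  integral at b = 1. Being positive and independent of b, it cancels from the convexity
  inequality.\<close>

lemma powr_resolvent_integral:
  fixes p :: real
  assumes p: "-1 < p" "p < 0"
  obtains c where "c > 0"
    "\<And>b. b > 0 \<Longrightarrow> integrable lborel (\<lambda>s. indicator {0<..} s * (s powr p / (b + s)))"
    "\<And>b. b > 0 \<Longrightarrow> (\<integral>s. indicator {0<..} s * (s powr p / (b + s)) \<partial>lborel) = c * b powr p"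
proof -
  define h :: "real \<Rightarrow> real \<Rightarrow> real" where "h = (\<lambda>b s. indicator {0<..} s * (s powr p / (b + s)))"
  have h_nonneg: "h 1 s \<ge> 0" for s by (auto simp: h_def indicator_def)
  have meas: "h b \<in> borel_measurable borel" for b unfolding h_def by measurable
  \<comment> \<open>Majorant for b = 1: s^p near 0, integrable as p > -1, and s^(p-1) near infinity,
    integrable as p < 0. Both pieces count at s = 1.\<close>
  have "integrable lborel (\<lambda>s. indicator {0..1} s * s powr p)"
    by (rule integrable_lborel_has_integral[OF _ _ _ has_integral_powr_from_0]) (use p in auto)
  moreover have "integrable lborel (\<lambda>s. indicator {1..} s * s powr (p - 1))"
    by (rule integrable_lborel_has_integral[OF _ _ _ has_integral_powr_to_inf]) (use p in auto)
  ultimately have "integrable lborel (\<lambda>s. indicator {0..1} s * s powr p + indicator {1..} s * s powr (p - 1))"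
    by (rule Bochner_Integration.integrable_add)
  then have int1: "integrable lborel (h 1)"
  proof (rule Bochner_Integration.integrable_bound)
    show "AE s in lborel. norm (h 1 s) \<le> norm (indicator {0..1} s * s powr p + indicator {1..} s * s powr (p - 1))"
    proof (rule AE_I2)
      fix s :: real
      consider "s \<le> 0" | "0 < s" "s < 1" | "s = 1" | "s > 1" by linarith
      then show "norm (h 1 s) \<le> norm (indicator {0..1} s * s powr p + indicator {1..} s * s powr (p - 1))"
        by cases (auto simp: h_def powr_diff divide_simps)
    qed
  qed (use meas in simp)
  define c where "c = (\<integral>s. h 1 s \<partial>lborel)"
  have "c > 0"
  proof -
    \<comment> \<open>A step function below the integrand: on [1,2], s^p >= 2^p because p < 0, and 1
      + s <= 3.\<close>
    have "(\<integral>s. indicator {1..2::real} s * (2 powr p / 3) \<partial>lborel) \<le> c"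
      unfolding c_def
    proof (rule integral_mono[OF _ int1])
      fix s :: real
      show "indicator {1..2::real} s * (2 powr p / 3) \<le> h 1 s"
      proof (cases "s \<in> {1..2}")
        case True
        then have "2 powr p \<le> s powr p" using p by (intro powr_mono2') auto
        then have "2 powr p / 3 \<le> s powr p / (1 + s)" using True by (intro frac_le) auto
        with True show ?thesis by (auto simp: h_def)
      qed (use h_nonneg in auto)
    qed auto
    moreover have "(\<integral>s. indicator {1..2::real} s * (2 powr p / 3) \<partial>lborel) = 2 powr p / (3::real)" by simp
    moreover have "2 powr p / (3::real) > 0" by simp
    ultimately show ?thesis by linarith
  qed
  \<comment> \<open>The kernel is homogeneous of degree p - 1, and the Jacobian b supplies the
    missing factor. The shape \<open>0 + b * s\<close> is that of an affine change of
    variables.\<close>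
  have scale: "h b (0 + b * s) = b powr (p - 1) * h 1 s" if "b > 0" for b s
    using that by (auto simp: h_def indicator_def powr_mult powr_diff zero_less_mult_iff field_simps)
  show ?thesis
  proof
    show "c > 0" by fact
    fix b :: real assume b: "b > 0"
    have "integrable lborel (\<lambda>s. h b (0 + b * s))"
      using int1 unfolding scale[OF b] by simp
    then show "integrable lborel (\<lambda>s. indicator {0<..} s * (s powr p / (b + s)))"
      using b lborel_integrable_real_affine_iff[of b "h b" 0] unfolding h_def by blast
    have "(\<integral>s. h b s \<partial>lborel) = \<bar>b\<bar> *\<^sub>R (\<integral>s. h b (0 + b * s) \<partial>lborel)"
      using b by (intro lborel_integral_real_affine) auto
    also have "\<dots> = c * b powr p"
      unfolding scale[OF b] using b by (simp add: c_def powr_diff)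
    finally show "(\<integral>s. indicator {0<..} s * (s powr p / (b + s)) \<partial>lborel) = c * b powr p"
      by (simp add: h_def)
  qed
qed

subsection \<open>Joint convexity of the power form\<close>

lemma cscalar_sum: "x \<in> carrier_vec n \<Longrightarrow> y \<in> carrier_vec n \<Longrightarrow> x \<bullet>c y = (\<Sum>k<n. x $ k * cnj (y $ k))"
  by (simp add: scalar_prod_def atLeast0LessThan)

text \<open>This is w^* (B + s)^{-1} w for B = \<open>spectral_mat n U b\<close>, written in the
  eigenbasis so that no inverse matrix has to be formed.\<close>

definition resolvent_form :: "nat \<Rightarrow> complex mat \<Rightarrow> (nat \<Rightarrow> real) \<Rightarrow> real \<Rightarrow> complex Matrix.vec \<Rightarrow> real" where
  "resolvent_form n U b s w = (\<Sum>k<n. (cmod ((ctrans U *\<^sub>v w) $ k))\<^sup>2 / (b k + s))"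

text \<open>The variational formula $w^* (B+s)^{-1} w = \max_x \, (2 \mathrm{Re}\, x^* w - x^* B x - s \|x\|^2)$
  exhibits the left-hand side as a supremum of functions that are affine in $(w, B)$.\<close>

lemma resolvent_form_upper:
  assumes U: "unitary_mat n U" and b: "\<And>k. k < n \<Longrightarrow> b k + s > 0"
    and x: "x \<in> carrier_vec n" and w: "w \<in> carrier_vec n"
  shows "2 * Re (w \<bullet>c x) - Re (qform n (spectral_mat n U b) x) - s * Re (x \<bullet>c x) \<le> resolvent_form n U b s w"
proof -
  note UD = unitary_matD[OF U]
  define X where "X = ctrans U *\<^sub>v x"
  define Y where "Y = ctrans U *\<^sub>v w"
  have car: "X \<in> carrier_vec n" "Y \<in> carrier_vec n"
    using UD x w unfolding X_def Y_def by (auto intro!: mult_mat_vec_carrier[of _ n n])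
  have 1: "w \<bullet>c x = (\<Sum>k<n. Y $ k * cnj (X $ k))"
    using unitary_cscalar[OF unitary_mat_ctrans[OF U] w x] car by (simp only: cscalar_sum X_def Y_def)
  have 2: "x \<bullet>c x = (\<Sum>k<n. X $ k * cnj (X $ k))"
    using unitary_cscalar[OF unitary_mat_ctrans[OF U] x x] car by (simp only: cscalar_sum X_def)
  \<comment> \<open>Completing the square in each coordinate: |y - (b_k + s) x|^2 >= 0, divided by
    b_k + s > 0.\<close>
  have pt: "2 * Re (Y $ k * cnj (X $ k)) - b k * (cmod (X $ k))\<^sup>2 - s * Re (X $ k * cnj (X $ k))
      \<le> (cmod (Y $ k))\<^sup>2 / (b k + s)" if "k < n" for k
  proof -
    have e: "(cmod (y - complex_of_real d * z))\<^sup>2 = (cmod y)\<^sup>2 - d * (2 * Re (y * cnj z) - d * (cmod z)\<^sup>2)"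
      for y z d unfolding cmod_power2 by (simp add: power2_eq_square algebra_simps)
    have "0 \<le> (cmod (Y $ k - complex_of_real (b k + s) * X $ k))\<^sup>2" by simp
    then have "(b k + s) * (2 * Re (Y $ k * cnj (X $ k)) - (b k + s) * (cmod (X $ k))\<^sup>2) \<le> (cmod (Y $ k))\<^sup>2"
      unfolding e by linarith
    then have "2 * Re (Y $ k * cnj (X $ k)) - (b k + s) * (cmod (X $ k))\<^sup>2 \<le> (cmod (Y $ k))\<^sup>2 / (b k + s)"
      using b[OF that] by (simp add: pos_le_divide_eq mult.commute)
    moreover have "Re (X $ k * cnj (X $ k)) = (cmod (X $ k))\<^sup>2"
      unfolding cmod_power2 by (simp add: power2_eq_square)
    ultimately show ?thesis by (simp only: distrib_right)
  qed
  have "2 * Re (w \<bullet>c x) - Re (qform n (spectral_mat n U b) x) - s * Re (x \<bullet>c x)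
     = (\<Sum>k<n. 2 * Re (Y $ k * cnj (X $ k)) - b k * (cmod (X $ k))\<^sup>2 - s * Re (X $ k * cnj (X $ k)))"
    unfolding 1 2 qform_spectral_mat[OF UD(1) x] X_def[symmetric]
    by (simp only: Re_sum Re_complex_of_real sum_subtractf sum_distrib_left)
  also have "\<dots> \<le> resolvent_form n U b s w"
    unfolding resolvent_form_def Y_def[symmetric] by (intro sum_mono pt) auto
  finally show ?thesis .
qed

lemma resolvent_form_attained:
  assumes U: "unitary_mat n U" and b: "\<And>k. k < n \<Longrightarrow> b k + s > 0" and w: "w \<in> carrier_vec n"
  obtains x where "x \<in> carrier_vec n"
    "resolvent_form n U b s w = 2 * Re (w \<bullet>c x) - Re (qform n (spectral_mat n U b) x) - s * Re (x \<bullet>c x)"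
proof -
  note UD = unitary_matD[OF U]
  define Y where "Y = ctrans U *\<^sub>v w"
  \<comment> \<open>The maximiser is (B + s)^{-1} w, at which the completed squares vanish; its
    eigenbasis coordinates are these quotients.\<close>
  define X where "X = Matrix.vec n (\<lambda>k. Y $ k / complex_of_real (b k + s))"
  define x where "x = U *\<^sub>v X"
  have car: "X \<in> carrier_vec n" "Y \<in> carrier_vec n" "x \<in> carrier_vec n"
    using UD w unfolding x_def Y_def by (auto simp: X_def intro!: mult_mat_vec_carrier[of _ n n])
  have "ctrans U *\<^sub>v x = (ctrans U * U) *\<^sub>v X"
    unfolding x_def using UD car by (intro assoc_mult_mat_vec[symmetric]) auto
  then have Ux: "ctrans U *\<^sub>v x = X" using UD car by simp
  have 1: "w \<bullet>c x = (\<Sum>k<n. Y $ k * cnj (X $ k))"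
    using unitary_cscalar[OF unitary_mat_ctrans[OF U] w car(3)] car by (simp only: cscalar_sum Ux Y_def)
  have 2: "x \<bullet>c x = (\<Sum>k<n. X $ k * cnj (X $ k))"
    using unitary_cscalar[OF unitary_mat_ctrans[OF U] car(3) car(3)] car by (simp only: cscalar_sum Ux)
  have pt: "(cmod (Y $ k))\<^sup>2 / (b k + s)
      = 2 * Re (Y $ k * cnj (X $ k)) - b k * (cmod (X $ k))\<^sup>2 - s * Re (X $ k * cnj (X $ k))" if "k < n" for k
  proof -
    define d where "d = b k + s"
    have d: "d > 0" using b[OF that] by (simp add: d_def)
    have Y: "Y $ k = complex_of_real d * X $ k" using d that by (simp add: X_def flip: d_def del: of_real_add)
    have X2: "Re (X $ k * cnj (X $ k)) = (cmod (X $ k))\<^sup>2"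
      unfolding cmod_power2 by (simp add: power2_eq_square)
    have "(cmod (Y $ k))\<^sup>2 / d = d * (cmod (X $ k))\<^sup>2"
      using d by (simp add: Y norm_mult power_mult_distrib power2_eq_square)
    moreover have "Re (Y $ k * cnj (X $ k)) = d * (cmod (X $ k))\<^sup>2"
      unfolding Y X2[symmetric] by (simp add: algebra_simps)
    ultimately show ?thesis
      unfolding X2 by (simp add: d_def algebra_simps)
  qed
  have "2 * Re (w \<bullet>c x) - Re (qform n (spectral_mat n U b) x) - s * Re (x \<bullet>c x)
     = (\<Sum>k<n. 2 * Re (Y $ k * cnj (X $ k)) - b k * (cmod (X $ k))\<^sup>2 - s * Re (X $ k * cnj (X $ k)))"
    unfolding 1 2 qform_spectral_mat[OF UD(1) car(3)] Ux
    by (simp only: Re_sum Re_complex_of_real sum_subtractf sum_distrib_left)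
  also have "\<dots> = resolvent_form n U b s w"
    unfolding resolvent_form_def Y_def[symmetric] by (intro sum.cong) (auto simp: pt)
  finally show ?thesis using that car(3) by metis
qed

text \<open>A maximiser \<open>x\<close> for the combined point competes at both endpoints. For
  fixed \<open>x\<close> the objective is affine in (w, B), so it splits into the two endpoint
  values, each bounded by its own maximum.\<close>

lemma resolvent_form_jointly_convex:
  assumes U: "unitary_mat n U" "unitary_mat n U1" "unitary_mat n U2"
    and b: "\<And>k. k < n \<Longrightarrow> b k > 0" "\<And>k. k < n \<Longrightarrow> b1 k > 0" "\<And>k. k < n \<Longrightarrow> b2 k > 0"
    and s: "s \<ge> 0" and t: "0 \<le> t" "t \<le> 1"
    and B: "spectral_mat n U b = complex_of_real t \<cdot>\<^sub>m spectral_mat n U1 b1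
        + complex_of_real (1 - t) \<cdot>\<^sub>m spectral_mat n U2 b2"
    and w: "w1 \<in> carrier_vec n" "w2 \<in> carrier_vec n"
  shows "resolvent_form n U b s (complex_of_real t \<cdot>\<^sub>v w1 + complex_of_real (1 - t) \<cdot>\<^sub>v w2)
    \<le> t * resolvent_form n U1 b1 s w1 + (1 - t) * resolvent_form n U2 b2 s w2"
proof -
  let ?w = "complex_of_real t \<cdot>\<^sub>v w1 + complex_of_real (1 - t) \<cdot>\<^sub>v w2"
  have bs: "b k + s > 0" "b1 k + s > 0" "b2 k + s > 0" if "k < n" for k
    using b[OF that] s by auto
  note UD = unitary_matD(1)[OF U(1)] unitary_matD(1)[OF U(2)] unitary_matD(1)[OF U(3)]
  have wc: "?w \<in> carrier_vec n" using w by simp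
  obtain x where x: "x \<in> carrier_vec n" and
    R: "resolvent_form n U b s ?w = 2 * Re (?w \<bullet>c x) - Re (qform n (spectral_mat n U b) x) - s * Re (x \<bullet>c x)"
    by (rule resolvent_form_attained[OF U(1) bs(1) wc])
  define r1 where "r1 = 2 * Re (w1 \<bullet>c x) - Re (qform n (spectral_mat n U1 b1) x) - s * Re (x \<bullet>c x)"
  define r2 where "r2 = 2 * Re (w2 \<bullet>c x) - Re (qform n (spectral_mat n U2 b2) x) - s * Re (x \<bullet>c x)"
  have wx: "?w \<bullet>c x = complex_of_real t * (w1 \<bullet>c x) + complex_of_real (1 - t) * (w2 \<bullet>c x)"
    using w x unfolding cscalar_sum[OF wc x] cscalar_sum[OF w(1) x] cscalar_sum[OF w(2) x]
    by (simp add: sum.distrib sum_distrib_left algebra_simps del: of_real_diff)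
  have q: "qform n (spectral_mat n U b) x = complex_of_real t * qform n (spectral_mat n U1 b1) x
      + complex_of_real (1 - t) * qform n (spectral_mat n U2 b2) x"
    unfolding B using UD by (simp add: qform_add[of _ n] qform_smult[of _ n] del: of_real_diff)
  have "resolvent_form n U b s ?w = t * r1 + (1 - t) * r2"
    unfolding R wx q r1_def r2_def by (simp add: algebra_simps del: of_real_diff)
  also have "\<dots> \<le> t * resolvent_form n U1 b1 s w1 + (1 - t) * resolvent_form n U2 b2 s w2"
    unfolding r1_def r2_def
    using resolvent_form_upper[OF U(2) bs(2) x w(1)] resolvent_form_upper[OF U(3) bs(3) x w(2)] t
    by (intro add_mono mult_left_mono) auto
  finally show ?thesis .
qed

lemma powr_form_jointly_convex:
  assumes p: "-1 \<le> p" "p < 0"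
    and U: "unitary_mat n U" "unitary_mat n U1" "unitary_mat n U2"
    and b: "\<And>k. k < n \<Longrightarrow> b k > 0" "\<And>k. k < n \<Longrightarrow> b1 k > 0" "\<And>k. k < n \<Longrightarrow> b2 k > 0"
    and t: "0 \<le> t" "t \<le> 1"
    and B: "spectral_mat n U b = complex_of_real t \<cdot>\<^sub>m spectral_mat n U1 b1
        + complex_of_real (1 - t) \<cdot>\<^sub>m spectral_mat n U2 b2"
    and w: "w1 \<in> carrier_vec n" "w2 \<in> carrier_vec n"
  defines "Q \<equiv> \<lambda>U b w. \<Sum>k<n. b k powr p * (cmod ((ctrans U *\<^sub>v w) $ k))\<^sup>2"
  shows "Q U b (complex_of_real t \<cdot>\<^sub>v w1 + complex_of_real (1 - t) \<cdot>\<^sub>v w2)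
    \<le> t * Q U1 b1 w1 + (1 - t) * Q U2 b2 w2"
proof (cases "p = -1")
  case True
  have Q: "Q V a v = resolvent_form n V a 0 v" if "\<And>k. k < n \<Longrightarrow> a k > 0" for V a v
    unfolding Q_def resolvent_form_def True
  proof (intro sum.cong refl)
    fix k assume "k \<in> {..<n}"
    then have "a k powr -1 = 1 / a k" using that by (intro powr_neg_one) auto
    then show "a k powr -1 * (cmod ((ctrans V *\<^sub>v v) $ k))\<^sup>2 = (cmod ((ctrans V *\<^sub>v v) $ k))\<^sup>2 / (a k + 0)"
      by (simp only:) simp
  qed
  show ?thesis
    using resolvent_form_jointly_convex[OF U b order.refl t B w] by (simp only: Q b)
next
  case False
  with p have "-1 < p" by simp
  define g where "g b s = indicator {0<..} s * (s powr p / (b + s))" for b s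
  from \<open>-1 < p\<close> obtain c where c: "c > 0"
    and int: "\<And>b. b > 0 \<Longrightarrow> integrable lborel (g b)"
    and val: "\<And>b. b > 0 \<Longrightarrow> (\<integral>s. g b s \<partial>lborel) = c * b powr p"
    unfolding g_def[abs_def] by (rule powr_resolvent_integral[OF _ p(2)]) blast
  \<comment> \<open>\<open>J\<close> is read in two ways: as a weighted resolvent form it is jointly
    convex for each s > 0, and as a sum of kernels \<open>g\<close> it integrates to c times
    \<open>Q\<close>.\<close>
  define J where "J V a v s = (indicator {0<..} s * s powr p) * resolvent_form n V a s v" for V a v s
  have J: "J V a v = (\<lambda>s. \<Sum>k<n. g (a k) s * (cmod ((ctrans V *\<^sub>v v) $ k))\<^sup>2)"
    for V a v unfolding J_def g_def resolvent_form_def sum_distrib_left by (intro ext sum.cong) auto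
  have intJ: "integrable lborel (J V a v)" if "\<And>k. k < n \<Longrightarrow> a k > 0" for V a v
    unfolding J by (intro Bochner_Integration.integrable_sum integrable_mult_left int) (use that in auto)
  have valJ: "(\<integral>s. J V a v s \<partial>lborel) = c * Q V a v" if a: "\<And>k. k < n \<Longrightarrow> a k > 0" for V a v
  proof -
    have "(\<integral>s. J V a v s \<partial>lborel) = (\<Sum>k<n. (c * a k powr p) * (cmod ((ctrans V *\<^sub>v v) $ k))\<^sup>2)"
      unfolding J using a int val
      by (subst Bochner_Integration.integral_sum) (auto intro!: sum.cong integrable_mult_left)
    then show ?thesis by (simp add: Q_def sum_distrib_left mult.assoc)
  qed
  let ?w = "complex_of_real t \<cdot>\<^sub>v w1 + complex_of_real (1 - t) \<cdot>\<^sub>v w2"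
  have "(\<integral>s. J U b ?w s \<partial>lborel) \<le> (\<integral>s. t * J U1 b1 w1 s + (1 - t) * J U2 b2 w2 s \<partial>lborel)"
  proof (rule integral_mono)
    fix s :: real
    show "J U b ?w s \<le> t * J U1 b1 w1 s + (1 - t) * J U2 b2 w2 s"
    proof (cases "s > 0")
      case True
      then have "s powr p * resolvent_form n U b s ?w
          \<le> s powr p * (t * resolvent_form n U1 b1 s w1 + (1 - t) * resolvent_form n U2 b2 s w2)"
        by (intro mult_left_mono resolvent_form_jointly_convex[OF U b _ t B w]) auto
      with True show ?thesis by (simp add: J_def algebra_simps)
    qed (simp add: J_def)
  qed (use intJ b in \<open>auto intro!: Bochner_Integration.integrable_add integrable_mult_right\<close>)
  also have "\<dots> = t * (\<integral>s. J U1 b1 w1 s \<partial>lborel) + (1 - t) * (\<integral>s. J U2 b2 w2 s \<partial>lborel)"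
    using intJ b by simp
  finally have "c * Q U b ?w \<le> c * (t * Q U1 b1 w1 + (1 - t) * Q U2 b2 w2)"
    using valJ b by (simp add: algebra_simps)
  with c show ?thesis by simp
qed

subsection \<open>The sandwich map\<close>

text \<open>A^(q/2) is Hermitian, so it moves onto the vector, and the form of B^p is diagonal in
  the eigenbasis of \<open>B\<close>. Sufficiency and necessity both evaluate the map through this
  formula.\<close>

lemma spectral_mat_sandwich:
  assumes V: "unitary_mat n V" and U: "unitary_mat n U"
    and a: "\<And>i. i < n \<Longrightarrow> a i > 0" and b: "\<And>i. i < n \<Longrightarrow> b i > 0"
  shows "hermitian_mat n (sandwich_map n p q (spectral_mat n V a) (spectral_mat n U b))"
    and "v \<in> carrier_vec n \<Longrightarrow> Re (qform n (sandwich_map n p q (spectral_mat n V a) (spectral_mat n U b)) v)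
      = (\<Sum>k<n. b k powr p * (cmod ((ctrans U *\<^sub>v (spectral_mat n V (\<lambda>i. a i powr (q/2)) *\<^sub>v v)) $ k))\<^sup>2)"
proof -
  define X where "X = spectral_mat n V (\<lambda>i. a i powr (q/2))"
  define K where "K = spectral_mat n U (\<lambda>i. b i powr p)"
  note UD = unitary_matD(1)[OF U] and VD = unitary_matD(1)[OF V]
  have X: "X \<in> carrier_mat n n" "ctrans X = X"
    using hermitian_spectral_mat[OF VD] by (auto simp: X_def hermitian_mat_def)
  have K: "hermitian_mat n K"
    using hermitian_spectral_mat[OF UD] by (simp add: K_def)
  have F: "sandwich_map n p q (spectral_mat n V a) (spectral_mat n U b) = X * K * X"
    unfolding sandwich_map_def X_def K_def
    by (simp add: mat_powr_spectral_mat[OF V a] mat_powr_spectral_mat[OF U b])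
  show "hermitian_mat n (sandwich_map n p q (spectral_mat n V a) (spectral_mat n U b))"
    using hermitian_congruence[OF K X(1)] unfolding F X(2) .
  assume v: "v \<in> carrier_vec n"
  have "qform n (X * K * X) v = qform n K (X *\<^sub>v v)"
    using qform_congruence[OF X(1) _ v, of K] K unfolding X(2) hermitian_mat_def by blast
  moreover have "X *\<^sub>v v \<in> carrier_vec n" using X v by (intro mult_mat_vec_carrier[of _ n n]) auto
  ultimately show "Re (qform n (sandwich_map n p q (spectral_mat n V a) (spectral_mat n U b)) v)
      = (\<Sum>k<n. b k powr p * (cmod ((ctrans U *\<^sub>v (spectral_mat n V (\<lambda>i. a i powr (q/2)) *\<^sub>v v)) $ k))\<^sup>2)"
    unfolding F X_def[symmetric] unfolding K_def by (simp only: qform_spectral_mat[OF UD] Re_complex_of_real)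
qed

lemma hermitian_sandwich_map:
  assumes "pos_def n A" "pos_def n B"
  shows "hermitian_mat n (sandwich_map n p q A B)"
proof -
  obtain V a where "unitary_mat n V" "A = spectral_mat n V a" "\<And>i. i < n \<Longrightarrow> a i > 0"
    using pos_def_spectral_decomposition[OF assms(1)] by metis
  moreover obtain U b where "unitary_mat n U" "B = spectral_mat n U b" "\<And>i. i < n \<Longrightarrow> b i > 0"
    using pos_def_spectral_decomposition[OF assms(2)] by metis
  ultimately show ?thesis using spectral_mat_sandwich(1) by simp
qed

text \<open>The form is linear in the matrix, so the averaged values split, while the value at the
  averaged point stays whole. The two parts serve convexity and concavity.\<close>

lemma loewner_le_sandwich_combination:
  fixes p q :: real
  assumes A: "pos_def n A1" "pos_def n A2" and B: "pos_def n B1" "pos_def n B2" and t: "0 \<le> t" "t \<le> 1"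
  defines "F \<equiv> sandwich_map n p q"
  defines "M \<equiv> F (complex_of_real t \<cdot>\<^sub>m A1 + complex_of_real (1 - t) \<cdot>\<^sub>m A2)
            (complex_of_real t \<cdot>\<^sub>m B1 + complex_of_real (1 - t) \<cdot>\<^sub>m B2)"
  defines "N \<equiv> complex_of_real t \<cdot>\<^sub>m F A1 B1 + complex_of_real (1 - t) \<cdot>\<^sub>m F A2 B2"
  shows "loewner_le n M N \<longleftrightarrow> (\<forall>v\<in>carrier_vec n.
      Re (qform n M v) \<le> t * Re (qform n (F A1 B1) v) + (1 - t) * Re (qform n (F A2 B2) v))"
    and "loewner_le n N M \<longleftrightarrow> (\<forall>v\<in>carrier_vec n.
      t * Re (qform n (F A1 B1) v) + (1 - t) * Re (qform n (F A2 B2) v) \<le> Re (qform n M v))"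
proof -
  have F: "hermitian_mat n (F A1 B1)" "hermitian_mat n (F A2 B2)" and M: "hermitian_mat n M"
    using A B t unfolding M_def F_def by (auto simp del: of_real_diff intro!: hermitian_sandwich_map pos_def_convex_combination)
  have N: "hermitian_mat n N" unfolding N_def using F by (rule hermitian_mat_combination)
  have "Re (qform n N v) = t * Re (qform n (F A1 B1) v) + (1 - t) * Re (qform n (F A2 B2) v)" for v
    using F unfolding N_def hermitian_mat_def
    by (simp add: qform_add[of _ n] qform_smult[of _ n] del: of_real_diff)
  then show "loewner_le n M N \<longleftrightarrow> (\<forall>v\<in>carrier_vec n.
      Re (qform n M v) \<le> t * Re (qform n (F A1 B1) v) + (1 - t) * Re (qform n (F A2 B2) v))"
    and "loewner_le n N M \<longleftrightarrow> (\<forall>v\<in>carrier_vec n.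
      t * Re (qform n (F A1 B1) v) + (1 - t) * Re (qform n (F A2 B2) v) \<le> Re (qform n M v))"
    by (simp_all only: loewner_le_iff[OF M N] loewner_le_iff[OF N M])
qed

lemma jointly_operator_convexD:
  assumes "jointly_operator_convex n F" "pos_def n A1" "pos_def n A2" "pos_def n B1" "pos_def n B2" "0 \<le> t" "t \<le> 1"
  shows "loewner_le n
      (F (complex_of_real t \<cdot>\<^sub>m A1 + complex_of_real (1 - t) \<cdot>\<^sub>m A2)
        (complex_of_real t \<cdot>\<^sub>m B1 + complex_of_real (1 - t) \<cdot>\<^sub>m B2))
      (complex_of_real t \<cdot>\<^sub>m F A1 B1 + complex_of_real (1 - t) \<cdot>\<^sub>m F A2 B2)"
  using assms unfolding jointly_operator_convex_def by blast

lemma jointly_operator_concaveD: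
  assumes "jointly_operator_concave n F" "pos_def n A1" "pos_def n A2" "pos_def n B1" "pos_def n B2" "0 \<le> t" "t \<le> 1"
  shows "loewner_le n
      (complex_of_real t \<cdot>\<^sub>m F A1 B1 + complex_of_real (1 - t) \<cdot>\<^sub>m F A2 B2)
      (F (complex_of_real t \<cdot>\<^sub>m A1 + complex_of_real (1 - t) \<cdot>\<^sub>m A2)
        (complex_of_real t \<cdot>\<^sub>m B1 + complex_of_real (1 - t) \<cdot>\<^sub>m B2))"
  using assms unfolding jointly_operator_concave_def by blast

lemma smult_mat_mult_vec:
  fixes A :: "'a::comm_semiring_0 mat"
  assumes "A \<in> carrier_mat m n" "v \<in> carrier_vec n"
  shows "(c \<cdot>\<^sub>m A) *\<^sub>v v = c \<cdot>\<^sub>v (A *\<^sub>v v)"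
  using assms by (intro eq_vecI) (auto simp: scalar_prod_def sum_distrib_left mult.assoc intro!: sum.cong)

text \<open>For q = 2 the outer factor is \<open>A\<close> itself, so the vector A v is affine in
  \<open>A\<close>; this turns joint convexity in (w, B) into joint convexity in (A, B).\<close>

lemma sandwich_map_jointly_convex:
  assumes p: "-1 \<le> p" "p < 0"
  shows "jointly_operator_convex n (sandwich_map n p 2)"
  unfolding jointly_operator_convex_def
proof (intro allI impI)
  fix A1 A2 B1 B2 t
  assume A: "pos_def n A1" "pos_def n A2" and B: "pos_def n B1" "pos_def n B2" and t: "0 \<le> t" "t \<le> (1::real)"
  define A where "A = complex_of_real t \<cdot>\<^sub>m A1 + complex_of_real (1 - t) \<cdot>\<^sub>m A2"
  define B where "B = complex_of_real t \<cdot>\<^sub>m B1 + complex_of_real (1 - t) \<cdot>\<^sub>m B2"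
  have A': "pos_def n A" and B': "pos_def n B"
    unfolding A_def B_def using A B t by (auto simp del: of_real_diff intro!: pos_def_convex_combination)
  obtain U1 b1 where U1: "unitary_mat n U1" "B1 = spectral_mat n U1 b1" and b1: "\<And>i. i < n \<Longrightarrow> b1 i > 0"
    using pos_def_spectral_decomposition[OF B(1)] by metis
  obtain U2 b2 where U2: "unitary_mat n U2" "B2 = spectral_mat n U2 b2" and b2: "\<And>i. i < n \<Longrightarrow> b2 i > 0"
    using pos_def_spectral_decomposition[OF B(2)] by metis
  obtain U b where U: "unitary_mat n U" "B = spectral_mat n U b" and b: "\<And>i. i < n \<Longrightarrow> b i > 0"
    using pos_def_spectral_decomposition[OF B'] by metis
  have form: "Re (qform n (sandwich_map n p 2 C (spectral_mat n W d)) v)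
      = (\<Sum>k<n. d k powr p * (cmod ((ctrans W *\<^sub>v (C *\<^sub>v v)) $ k))\<^sup>2)"
    if C: "pos_def n C" and W: "unitary_mat n W" and d: "\<And>i. i < n \<Longrightarrow> d i > 0" and v: "v \<in> carrier_vec n"
    for C W d v
  proof -
    obtain V a where V: "unitary_mat n V" and CV: "C = spectral_mat n V a" and a: "\<And>i. i < n \<Longrightarrow> a i > 0"
      using pos_def_spectral_decomposition[OF C] by metis
    \<comment> \<open>Compared as matrices, since \<open>a i\<close> is known to be positive only
      for i < n.\<close>
    have "mat_diag n (\<lambda>i. complex_of_real (a i powr 1)) = mat_diag n (\<lambda>i. complex_of_real (a i))"
      by (rule eq_matI) (auto simp: mat_diag_def less_imp_le[OF a])
    then have X: "spectral_mat n V (\<lambda>i. a i powr (2/2)) = C"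
      by (simp add: spectral_mat_def CV)
    have "Re (qform n (sandwich_map n p 2 (spectral_mat n V a) (spectral_mat n W d)) v)
        = (\<Sum>k<n. d k powr p * (cmod ((ctrans W *\<^sub>v (spectral_mat n V (\<lambda>i. a i powr (2/2)) *\<^sub>v v)) $ k))\<^sup>2)"
      by (rule spectral_mat_sandwich(2)[OF V W a d v])
    then show ?thesis unfolding X CV[symmetric] .
  qed
  have car: "A1 \<in> carrier_mat n n" "A2 \<in> carrier_mat n n"
    using A by (auto simp: pos_def_def hermitian_mat_def)
  have "Re (qform n (sandwich_map n p 2 A B) v)
      \<le> t * Re (qform n (sandwich_map n p 2 A1 B1) v) + (1 - t) * Re (qform n (sandwich_map n p 2 A2 B2) v)"
    if v: "v \<in> carrier_vec n" for v
  proof -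
    have w: "A1 *\<^sub>v v \<in> carrier_vec n" "A2 *\<^sub>v v \<in> carrier_vec n"
      using car v by (auto intro!: mult_mat_vec_carrier[of _ n n])
    have "A *\<^sub>v v = complex_of_real t \<cdot>\<^sub>v (A1 *\<^sub>v v) + complex_of_real (1 - t) \<cdot>\<^sub>v (A2 *\<^sub>v v)"
      unfolding A_def using car v
      by (simp add: add_mult_distrib_mat_vec[of _ n n] smult_mat_mult_vec[of _ n n] del: of_real_diff)
    moreover have "Re (qform n (sandwich_map n p 2 A B) v) = (\<Sum>k<n. b k powr p * (cmod ((ctrans U *\<^sub>v (A *\<^sub>v v)) $ k))\<^sup>2)"
      unfolding U(2) by (rule form[OF A' U(1) b v])
    moreover have "Re (qform n (sandwich_map n p 2 A1 B1) v) = (\<Sum>k<n. b1 k powr p * (cmod ((ctrans U1 *\<^sub>v (A1 *\<^sub>v v)) $ k))\<^sup>2)"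
      unfolding U1(2) by (rule form[OF A(1) U1(1) b1 v])
    moreover have "Re (qform n (sandwich_map n p 2 A2 B2) v) = (\<Sum>k<n. b2 k powr p * (cmod ((ctrans U2 *\<^sub>v (A2 *\<^sub>v v)) $ k))\<^sup>2)"
      unfolding U2(2) by (rule form[OF A(2) U2(1) b2 v])
    moreover have "spectral_mat n U b = complex_of_real t \<cdot>\<^sub>m spectral_mat n U1 b1 + complex_of_real (1 - t) \<cdot>\<^sub>m spectral_mat n U2 b2"
      unfolding U(2)[symmetric] U1(2)[symmetric] U2(2)[symmetric] B_def ..
    note powr_form_jointly_convex[OF p U(1) U1(1) U2(1) b b1 b2 t this w]
    ultimately show ?thesis by (simp only:)
  qed
  then show "loewner_le n
         (sandwich_map n p 2 (complex_of_real t \<cdot>\<^sub>m A1 + complex_of_real (1 - t) \<cdot>\<^sub>m A2)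
            (complex_of_real t \<cdot>\<^sub>m B1 + complex_of_real (1 - t) \<cdot>\<^sub>m B2))
         (complex_of_real t \<cdot>\<^sub>m sandwich_map n p 2 A1 B1 + complex_of_real (1 - t) \<cdot>\<^sub>m sandwich_map n p 2 A2 B2)"
    unfolding loewner_le_sandwich_combination(1)[OF A B t] A_def B_def by blast
qed

section \<open>Necessity: positive weights and test matrices\<close>

lemma sum_pos_weights_nonneg_imp:
  fixes c :: "nat \<Rightarrow> real"
  assumes nn: "\<And>m. (\<And>k. m k > 0) \<Longrightarrow> (\<Sum>k<n. m k * c k) \<ge> 0" and j: "j < n"
  shows "c j \<ge> 0"
proof (rule ccontr)
  assume neg: "\<not> c j \<ge> 0"
  define R where "R = (\<Sum>k\<in>{..<n} - {j}. c k)"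
  define d where "d = \<bar>R\<bar> + 1"
  have d: "d > 0" "R \<le> d" by (auto simp: d_def)
  \<comment> \<open>Weight 1 on \<open>j\<close> and \<epsilon> elsewhere imitates a rank-one limit
    with strictly positive weights; this \<epsilon> keeps the other terms together at most
    -c_j/2.\<close>
  define \<epsilon> where "\<epsilon> = - c j / (2 * d)"
  have \<epsilon>: "\<epsilon> > 0" using neg d unfolding \<epsilon>_def by (intro divide_pos_pos) auto
  have "0 \<le> (\<Sum>k<n. (if k = j then 1 else \<epsilon>) * c k)"
    by (rule nn) (use \<epsilon> in auto)
  also have "\<dots> = c j + \<epsilon> * R"
    using j by (subst sum.remove[of _ j]) (auto simp: R_def sum_distrib_left intro!: sum.cong)
  also have "\<epsilon> * R \<le> \<epsilon> * d" using \<epsilon> d by (intro mult_left_mono) auto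
  also have "\<dots> = - c j / 2" using d by (simp add: \<epsilon>_def)
  finally show False using neg by simp
qed

lemma quadratic_nonneg_imp_linear_zero:
  fixes a c :: real
  assumes "\<And>y. 2 * y * a + y\<^sup>2 * c \<ge> 0"
  shows "a = 0"
proof (rule ccontr)
  assume "a \<noteq> 0"
  define d where "d = \<bar>c\<bar> + 1"
  have d: "d > 0" "c \<le> d" by (auto simp: d_def)
  \<comment> \<open>The choice y = -a/d, scaled by d^2, gives a^2 (c - 2 d), which is negative since
    c <= d and d > 0.\<close>
  have "0 \<le> d\<^sup>2 * (2 * (- a / d) * a + (- a / d)\<^sup>2 * c)"
    by (intro mult_nonneg_nonneg assms) simp
  also have "\<dots> = a\<^sup>2 * (c - 2 * d)"
    using d by (simp add: field_simps power2_eq_square)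
  also have "\<dots> < 0" using d \<open>a \<noteq> 0\<close> by (intro mult_pos_neg) auto
  finally show False by simp
qed

text \<open>Column 0 is (e_0 + e_1)/sqrt 2. The rank-one form on it sees the sum of the first two
  coordinates of a vector, so the entries of a diagonal matrix acting there interfere.\<close>

definition hadamard_block :: "nat \<Rightarrow> complex mat" where
  "hadamard_block n = Matrix.mat n n (\<lambda>(i,j). if i < 2 \<and> j < 2
     then (if i = 1 \<and> j = 1 then -1 else 1) / complex_of_real (sqrt 2) else if i = j then 1 else 0)"

lemma sum_lessThan_split2:
  fixes f :: "nat \<Rightarrow> 'a::comm_monoid_add"
  assumes "n \<ge> 2"
  shows "(\<Sum>k<n. f k) = f 0 + f 1 + (\<Sum>k\<in>{2..<n}. f k)"
proof -
  have "{..<n} = insert 0 (insert 1 {2..<n})" using assms by auto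
  then show ?thesis by (simp add: add.assoc)
qed

lemma unitary_hadamard_block:
  assumes n: "n \<ge> 2"
  shows "unitary_mat n (hadamard_block n)"
  unfolding unitary_mat_iff
proof (intro conjI allI impI)
  let ?H = "hadamard_block n"
  show "?H \<in> carrier_mat n n" by (simp add: hadamard_block_def)
  fix i j assume ij: "i < n" "j < n"
  have s: "complex_of_real (sqrt 2) * complex_of_real (sqrt 2) = 2"
    by (simp flip: of_real_mult)
  have tail: "(\<Sum>k\<in>{2..<n}. cnj (?H $$ (k,i)) * ?H $$ (k,j)) = (if i = j \<and> i \<ge> 2 then 1 else 0)"
  proof -
    have "(\<Sum>k\<in>{2..<n}. cnj (?H $$ (k,i)) * ?H $$ (k,j))
        = (\<Sum>k\<in>{2..<n}. if k = i then (if i = j then 1 else 0) else 0)"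
      using ij by (intro sum.cong) (auto simp: hadamard_block_def)
    then show ?thesis using ij by simp
  qed
  consider "i = 0" | "i = 1" | "i \<ge> 2" by linarith
  then show "(\<Sum>k<n. cnj (?H $$ (k,i)) * ?H $$ (k,j)) = (if i = j then 1 else 0)"
    unfolding sum_lessThan_split2[OF n] tail using n ij s
    by cases (auto simp: hadamard_block_def)
qed

lemma spectral_mat_one_mult_vec:
  "v \<in> carrier_vec n \<Longrightarrow> spectral_mat n (1\<^sub>m n) d *\<^sub>v v = Matrix.vec n (\<lambda>i. complex_of_real (d i) * v $ i)"
proof (rule eq_vecI)
  fix i assume v: "v \<in> carrier_vec n" and "i < dim_vec (Matrix.vec n (\<lambda>i. complex_of_real (d i) * v $ i))"
  then have i: "i < n" by simp
  from v i show "(spectral_mat n (1\<^sub>m n) d *\<^sub>v v) $ i = Matrix.vec n (\<lambda>i. complex_of_real (d i) * v $ i) $ i"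
    by (simp add: spectral_mat_one mat_diag_def scalar_prod_def atLeast0LessThan if_distrib[of "\<lambda>x. x * _"] cong: if_cong)
qed (simp add: spectral_mat_one mat_diag_def)

lemma spectral_mat_combination:
  assumes "U \<in> carrier_mat n n"
  shows "complex_of_real s \<cdot>\<^sub>m spectral_mat n U a + complex_of_real t \<cdot>\<^sub>m spectral_mat n U b
    = spectral_mat n U (\<lambda>i. s * a i + t * b i)"
proof (rule eq_matI)
  note d = carrier_matD[OF spectral_mat_carrier[OF assms]]
  fix i j assume "i < dim_row (spectral_mat n U (\<lambda>i. s * a i + t * b i))"
    "j < dim_col (spectral_mat n U (\<lambda>i. s * a i + t * b i))"
  then have ij: "i < n" "j < n" by (simp_all add: d)
  then show "(complex_of_real s \<cdot>\<^sub>m spectral_mat n U a + complex_of_real t \<cdot>\<^sub>m spectral_mat n U b) $$ (i, j)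
    = spectral_mat n U (\<lambda>i. s * a i + t * b i) $$ (i, j)"
    by (simp add: d spectral_mat_index[OF assms ij] sum_distrib_left sum.distrib algebra_simps)
qed (simp_all add: carrier_matD[OF spectral_mat_carrier[OF assms]])

text \<open>With $A$ diagonal and $B = H \, \mathrm{diag}(\kappa) \, H^*$ fixed, the quadratic form of the map is
  linear in the weights $\kappa_k^p$, which are arbitrary positive numbers, so each coefficient
  inherits the convexity. For $v = e_0 + y e_1$ the coefficient of $\kappa_0^p$ is
  $(1 + y b^{q/2})^2 / 2$ at $A = \mathrm{diag}(1, b, 1, \dots)$; it is tested at $b = 1, 2, 3$.\<close>

lemma sandwich_weights:
  fixes p q :: real
  assumes p: "p \<noteq> 0" and n: "n \<ge> 2" and b: "b > 0" and m: "\<And>k. m k > 0"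
  defines "D \<equiv> \<lambda>b. spectral_mat n (1\<^sub>m n) (\<lambda>i. if i = 1 then b else (1::real))"
  defines "K \<equiv> spectral_mat n (hadamard_block n) (\<lambda>k. m k powr (1/p))"
  defines "v \<equiv> \<lambda>y. Matrix.vec n (\<lambda>i. if i = 0 then 1 else if i = 1 then complex_of_real y else 0)"
  defines "g \<equiv> \<lambda>b y k. (cmod ((ctrans (hadamard_block n) *\<^sub>v (spectral_mat n (1\<^sub>m n) (\<lambda>i. (if i = 1 then b else (1::real)) powr (q/2)) *\<^sub>v v y)) $ k))\<^sup>2"
  shows "Re (qform n (sandwich_map n p q (D b) K) (v y)) = (\<Sum>k<n. m k * g b y k)"
    and "g b y 0 = (1 + y * b powr (q/2))\<^sup>2 / 2"
proof -
  let ?H = "hadamard_block n"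
  have v: "v y \<in> carrier_vec n" by (simp add: v_def)
  \<comment> \<open>\<open>K\<close> has the eigenvalues \<open>m k powr (1/p)\<close>, so its p-th
    power carries the prescribed weights; here p must be nonzero.\<close>
  have pw: "(m k powr (1/p)) powr p = m k" for k
    using m[of k] p by (simp add: powr_powr)
  have "Re (qform n (sandwich_map n p q (D b) K) (v y)) = (\<Sum>k<n. (m k powr (1/p)) powr p * g b y k)"
    unfolding D_def K_def g_def
    by (rule spectral_mat_sandwich(2)[OF unitary_mat_one unitary_hadamard_block[OF n] _ _ v])
      (use b m in \<open>auto simp: less_le\<close>)
  then show "Re (qform n (sandwich_map n p q (D b) K) (v y)) = (\<Sum>k<n. m k * g b y k)"
    unfolding pw .
  have H: "?H \<in> carrier_mat n n" by (simp add: hadamard_block_def)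
  have "(ctrans ?H *\<^sub>v (spectral_mat n (1\<^sub>m n) (\<lambda>i. (if i = 1 then b else 1) powr (q/2)) *\<^sub>v v y)) $ 0
     = (\<Sum>k<n. cnj (?H $$ (k,0)) * (complex_of_real ((if k = 1 then b else 1) powr (q/2)) * v y $ k))"
    unfolding spectral_mat_one_mult_vec[OF v] using n H by (simp add: scalar_prod_def atLeast0LessThan)
  also have "\<dots> = complex_of_real ((1 + y * b powr (q/2)) / sqrt 2)"
    unfolding sum_lessThan_split2[OF n] using n by (simp add: v_def hadamard_block_def add_divide_distrib mult.commute)
  finally have "(ctrans ?H *\<^sub>v (spectral_mat n (1\<^sub>m n) (\<lambda>i. (if i = 1 then b else 1) powr (q/2)) *\<^sub>v v y)) $ 0
     = complex_of_real ((1 + y * b powr (q/2)) / sqrt 2)" .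
  then show "g b y 0 = (1 + y * b powr (q/2))\<^sup>2 / 2"
    unfolding g_def by (simp only: norm_of_real power2_abs power_divide real_sqrt_pow2 zero_le_numeral)
qed

text \<open>\<open>T\<close> and \<open>C\<close> are the second differences at 1, 2, 3 of b^(q/2)
  and of its square. In the second difference of (1 + y b^(q/2))^2 the constants cancel, which
  leaves the stated quadratic in y.\<close>

lemma sandwich_midpoint_conditions:
  fixes p q :: real
  assumes p: "p \<noteq> 0" and n: "n \<ge> 2"
  defines "T \<equiv> 1 + 3 powr (q/2) - 2 * 2 powr (q/2)"
  defines "C \<equiv> 1 + (3 powr (q/2))\<^sup>2 - 2 * (2 powr (q/2))\<^sup>2"
  shows "jointly_operator_convex n (sandwich_map n p q) \<Longrightarrow> 2 * y * T + y\<^sup>2 * C \<ge> 0"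
    and "jointly_operator_concave n (sandwich_map n p q) \<Longrightarrow> 2 * y * T + y\<^sup>2 * C \<le> 0"
proof -
  define D where "D b = spectral_mat n (1\<^sub>m n) (\<lambda>i. if i = 1 then b else (1::real))" for b
  define K where "K m = spectral_mat n (hadamard_block n) (\<lambda>k. m k powr (1/p))" for m
  define v where "v = Matrix.vec n (\<lambda>i. if i = 0 then 1 else if i = 1 then complex_of_real y else 0)"
  define g where "g b k = (cmod ((ctrans (hadamard_block n) *\<^sub>v (spectral_mat n (1\<^sub>m n) (\<lambda>i. (if i = 1 then b else (1::real)) powr (q/2)) *\<^sub>v v)) $ k))\<^sup>2" for b k
  let ?F = "sandwich_map n p q"
  have v: "v \<in> carrier_vec n" by (simp add: v_def)
  have D: "pos_def n (D b)" if "b > 0" for b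
    unfolding D_def using that by (intro pos_def_spectral_mat unitary_mat_one) auto
  have K: "pos_def n (K m)" if "\<And>k. m k > 0" for m
    unfolding K_def using that by (intro pos_def_spectral_mat unitary_hadamard_block n) (auto simp: less_le)
  have form: "Re (qform n (?F (D b) (K m)) v) = (\<Sum>k<n. m k * g b k)" if "b > 0" "\<And>k. m k > 0" for b m
    unfolding D_def K_def g_def v_def by (rule sandwich_weights(1)[OF p n that])
  have g0: "g b 0 = (1 + y * b powr (q/2))\<^sup>2 / 2" if "b > 0" for b
    unfolding g_def v_def by (rule sandwich_weights(2)[OF p n that, where m = "\<lambda>_. 1"]) simp
  \<comment> \<open>Midpoint defect of the k-th coefficient; the 4 below clears the halves from the
    average and from \<open>g0\<close>.\<close>
  define c where "c k = 1/2 * g 1 k + 1/2 * g 3 k - g 2 k" for k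
  have c0: "4 * c 0 = 2 * y * T + y\<^sup>2 * C"
    by (simp add: c_def g0 T_def C_def power2_eq_square field_simps)
  have mid: "complex_of_real (1/2) \<cdot>\<^sub>m D 1 + complex_of_real (1 - 1/2) \<cdot>\<^sub>m D 3 = D 2"
    unfolding D_def spectral_mat_combination[OF one_carrier_mat]
    by (rule arg_cong[where f = "spectral_mat n (1\<^sub>m n)"]) auto
  have midK: "complex_of_real (1/2) \<cdot>\<^sub>m K m + complex_of_real (1 - 1/2) \<cdot>\<^sub>m K m = K m" for m
    unfolding K_def spectral_mat_combination[OF unitary_matD(1)[OF unitary_hadamard_block[OF n]]]
    by (rule arg_cong[where f = "spectral_mat n (hadamard_block n)"]) auto
  have lin: "(\<Sum>k<n. m k * c k) = 1/2 * (\<Sum>k<n. m k * g 1 k) + (1 - 1/2) * (\<Sum>k<n. m k * g 3 k) - (\<Sum>k<n. m k * g 2 k)" for m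
    by (simp add: c_def sum_distrib_left sum.distrib sum_subtractf algebra_simps)
  have half: "0 \<le> (1/2::real)" "1/2 \<le> (1::real)" by auto
  have D13: "pos_def n (D 1)" "pos_def n (D 3)" by (simp_all add: D)
  {
    assume cv: "jointly_operator_convex n ?F"
    have "(\<Sum>k<n. m k * c k) \<ge> 0" if m: "\<And>k. m k > 0" for m
    proof -
      have Km: "pos_def n (K m)" using m by (rule K)
      have "loewner_le n (?F (D 2) (K m)) (complex_of_real (1/2) \<cdot>\<^sub>m ?F (D 1) (K m) + complex_of_real (1 - 1/2) \<cdot>\<^sub>m ?F (D 3) (K m))"
        using jointly_operator_convexD[OF cv D13 Km Km half] unfolding mid midK .
      then have "Re (qform n (?F (D 2) (K m)) v) \<le> 1/2 * Re (qform n (?F (D 1) (K m)) v) + (1 - 1/2) * Re (qform n (?F (D 3) (K m)) v)"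
        using loewner_le_sandwich_combination(1)[OF D13 Km Km half, of p q] v unfolding mid midK by blast
      then show ?thesis
        unfolding lin using m by (simp add: form)
    qed
    then have "c 0 \<ge> 0" by (rule sum_pos_weights_nonneg_imp[where c = c]) (use n in auto)
    with c0 show "2 * y * T + y\<^sup>2 * C \<ge> 0" by simp
  }
  {
    assume cc: "jointly_operator_concave n ?F"
    have "(\<Sum>k<n. m k * (- c k)) \<ge> 0" if m: "\<And>k. m k > 0" for m
    proof -
      have Km: "pos_def n (K m)" using m by (rule K)
      have "loewner_le n (complex_of_real (1/2) \<cdot>\<^sub>m ?F (D 1) (K m) + complex_of_real (1 - 1/2) \<cdot>\<^sub>m ?F (D 3) (K m)) (?F (D 2) (K m))"
        using jointly_operator_concaveD[OF cc D13 Km Km half] unfolding mid midK .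
      then have "1/2 * Re (qform n (?F (D 1) (K m)) v) + (1 - 1/2) * Re (qform n (?F (D 3) (K m)) v) \<le> Re (qform n (?F (D 2) (K m)) v)"
        using loewner_le_sandwich_combination(2)[OF D13 Km Km half, of p q] v unfolding mid midK by blast
      then have "(\<Sum>k<n. m k * c k) \<le> 0"
        unfolding lin using m by (simp add: form)
      then show ?thesis by (simp add: sum_negf)
    qed
    then have "- c 0 \<ge> 0" by (rule sum_pos_weights_nonneg_imp[where c = "\<lambda>k. - c k"]) (use n in auto)
    with c0 show "2 * y * T + y\<^sup>2 * C \<le> 0" by simp
  }
qed

text \<open>On scalar matrices, convexity of $a^2 b^p$ tested at $a = b^{-p}$ says that $b^{-p}$ is
  midpoint concave.\<close>

lemma sandwich_convex_exponent:
  assumes n: "n \<ge> 1" and cv: "jointly_operator_convex n (sandwich_map n p 2)"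
  shows "-1 \<le> p" "p \<le> 0"
proof -
  define S where "S a = spectral_mat n (1\<^sub>m n) (\<lambda>_. a)" for a :: real
  define v where "v = (unit_vec n 0 :: complex Matrix.vec)"
  let ?F = "sandwich_map n p 2"
  have v: "v \<in> carrier_vec n" by (simp add: v_def)
  have S: "pos_def n (S a)" if "a > 0" for a
    unfolding S_def using that by (intro pos_def_spectral_mat unitary_mat_one) auto
  have form: "Re (qform n (?F (S a) (S b)) v) = b powr p * a\<^sup>2" if "a > 0" "b > 0" for a b
  proof -
    have "Re (qform n (?F (S a) (S b)) v) = (\<Sum>k<n. b powr p * (cmod ((ctrans (1\<^sub>m n) *\<^sub>v (spectral_mat n (1\<^sub>m n) (\<lambda>_. a powr (2/2)) *\<^sub>v v)) $ k))\<^sup>2)"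
      unfolding S_def by (rule spectral_mat_sandwich(2)[OF unitary_mat_one unitary_mat_one _ _ v]) (use that in auto)
    also have "\<dots> = (\<Sum>k<n. if k = 0 then b powr p * a\<^sup>2 else 0)"
      unfolding spectral_mat_one_mult_vec[OF v] using that
      by (intro sum.cong) (auto simp: v_def one_mult_mat_vec[of _ n] norm_mult)
    finally show ?thesis using n by simp
  qed
  define s where "s = - p"
  have comb: "complex_of_real (1/2) \<cdot>\<^sub>m S a + complex_of_real (1 - 1/2) \<cdot>\<^sub>m S b = S ((a + b) / 2)" for a b
    unfolding S_def spectral_mat_combination[OF one_carrier_mat]
    by (rule arg_cong[where f = "spectral_mat n (1\<^sub>m n)"]) (auto simp: field_simps)
  have half: "0 \<le> (1/2::real)" "1/2 \<le> (1::real)" by auto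
  have pos: "(3::real) powr s > 0" "(1::real) > 0" "(3::real) > 0" by auto
  have S2: "complex_of_real (1/2) \<cdot>\<^sub>m S 1 + complex_of_real (1 - 1/2) \<cdot>\<^sub>m S 3 = S 2"
    unfolding comb by simp
  note jointly_operator_convexD[OF cv S[OF pos(2)] S[OF pos(1)] S[OF pos(2)] S[OF pos(3)] half]
  then have "Re (qform n (?F (S ((1 + 3 powr s) / 2)) (S 2)) v)
      \<le> 1/2 * Re (qform n (?F (S 1) (S 1)) v) + (1 - 1/2) * Re (qform n (?F (S (3 powr s)) (S 3)) v)"
    using loewner_le_sandwich_combination(1)[OF S[OF pos(2)] S[OF pos(1)] S[OF pos(2)] S[OF pos(3)] half, of p 2] v
    unfolding S2 comb by simp
  \<comment> \<open>For a = b^s the value b^p a^2 equals a, so the right-hand side becomes m = (1 +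
    3^s)/2. Convexity reads 2^p m^2 <= m, and cancelling m > 0 gives m <= 2^s.\<close>
  moreover have "3 powr p * (3 powr s)\<^sup>2 = 3 powr s"
    by (simp add: s_def power2_eq_square flip: powr_add)
  ultimately have "2 powr p * ((1 + 3 powr s) / 2)\<^sup>2 \<le> (1 + 3 powr s) / 2"
    by (simp add: form add_pos_pos)
  then have "(1 + 3 powr s) / 2 * (2 powr p * ((1 + 3 powr s) / 2)) \<le> (1 + 3 powr s) / 2 * 1"
    by (simp add: power2_eq_square mult_ac)
  then have "2 powr p * ((1 + 3 powr s) / 2) \<le> 1"
    by (rule mult_left_le_imp_le) (intro divide_pos_pos add_pos_pos, auto)
  then have "2 powr s * (2 powr p * ((1 + 3 powr s) / 2)) \<le> 2 powr s * 1"
    by (intro mult_left_mono) auto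
  moreover have "2 powr s * 2 powr p = (1::real)"
    by (simp add: s_def flip: powr_add)
  ultimately have "1 + 3 powr s \<le> 2 * 2 powr s"
    by (simp flip: mult.assoc)
  from powr_midpoint_le_imp[OF this] show "-1 \<le> p" "p \<le> 0"
    by (auto simp: s_def)
qed

theorem theorem3p2:
  fixes p q :: real and n :: nat
  assumes "p \<noteq> 0" and "q \<noteq> 0" and "n \<ge> 2"
  shows "(jointly_operator_convex n (sandwich_map n p q) \<longleftrightarrow> q = 2 \<and> -1 \<le> p \<and> p < 0)
         \<and> \<not> jointly_operator_concave n (sandwich_map n p q)"
proof (intro conjI iffI notI)
  have q_eq: "q = 2" if "1 + 3 powr (q/2) - 2 * 2 powr (q/2) = 0"
    using powr_midpoint_eq_imp[of "q/2"] that assms(2) by simp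
  show "q = 2" if "jointly_operator_convex n (sandwich_map n p q)"
    by (rule q_eq, rule quadratic_nonneg_imp_linear_zero)
      (rule sandwich_midpoint_conditions(1)[OF assms(1,3) that])
  then show "-1 \<le> p" "p < 0" if "jointly_operator_convex n (sandwich_map n p q)"
    using sandwich_convex_exponent[of n p] that assms by (auto simp: less_le)
  show "jointly_operator_convex n (sandwich_map n p q)" if "q = 2 \<and> -1 \<le> p \<and> p < 0"
    using that sandwich_map_jointly_convex by simp
  assume "jointly_operator_concave n (sandwich_map n p q)"
  note le = sandwich_midpoint_conditions(2)[OF assms(1,3) this]
  \<comment> \<open>Concavity reverses the sign, so both coefficients of the quadratic are
    negated.\<close>
  have "- (1 + 3 powr (q/2) - 2 * 2 powr (q/2)) = 0"
    by (rule quadratic_nonneg_imp_linear_zero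
        [of _ "- (1 + (3 powr (q/2))\<^sup>2 - 2 * (2 powr (q/2))\<^sup>2)"])
      (use le in \<open>simp add: algebra_simps\<close>)
  then have "q = 2" by (intro q_eq) simp
  \<comment> \<open>At q = 2 the linear coefficient vanishes and the quadratic one is 1 + 9 - 8 = 2,
    so y = 1 gives 2 <= 0.\<close>
  with le[of 1] show False by simp
qed

end
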